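(* Let $ABC$ be a triangle that is cut into finitely many triangles (tiles), each congruent to a fixed triangle with side lengths $a,b,c$. Suppose that: (i) exactly one tile has a vertex at $A$; (ii) at every boundary vertex of the tiling an odd number of tiles meet; (iii) at every interior vertex of the tiling an even number of tiles meet; (iv) the number of tiles having a vertex at $B$ and the number of tiles having a vertex at $C$ are either both even or both odd. Then every tile can be colored black or white in such a way that any two tiles whose boundaries share a segment of positive length receive different colors, and the tile at $A$ is black. Let $M$ be the number of black tiles minus the number of white tiles. Let $Y$ be the length of side $BC$ (opposite $A$) and $X, Z$ the lengths of the other two sides. Then $$X \pm Y + Z = M(a+b+c),$$ where the sign is $+$ if the numbers of tiles at $B$ and at $C$ are odd and $-$ if they are even.
   Context: A tiling of $ABC$ means a decomposition of $ABC$ into triangles with pairwise disjoint interiors whose union is $ABC$. A vertex of the tiling is a point that is a vertex of some tile. A vertex other than $A,B,C$ is a boundary vertex if it lies on the boundary of $ABC$ or in the relative interior of an edge of some tile, so that the angles of the tiles having a vertex there sum to $\pi$; it is an interior vertex if the angles of the tiles having a vertex there sum to $2\pi$. *)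

theory Defs
  imports "HOL-Analysis.Analysis"
begin

definition congruent_sets :: "'a::euclidean_space set \<Rightarrow> 'a set \<Rightarrow> bool" where
  "congruent_sets S T \<longleftrightarrow> (\<exists>f. (\<forall>x y. dist (f x) (f y) = dist x y) \<and> f ` S = T)"

text \<open>A triangle is a non-degenerate solid triangle, i.e. a set \<open>T\<close> with \<open>2 simplex T\<close>. Its
  vertices are its extreme points and its sides are its one-dimensional faces (\<open>edge_of\<close>).
  Since tiles have non-empty interior, nothing is lost by taking a tiling to be a set of tiles.\<close>

definition tiling :: "'a::euclidean_space set set \<Rightarrow> 'a set \<Rightarrow> bool" where
  "tiling \<T> S \<longleftrightarrow> finite \<T> \<and> (\<forall>T\<in>\<T>. 2 simplex T) \<and>
     pairwise (\<lambda>T U. interior T \<inter> interior U = {}) \<T> \<and> \<Union>\<T> = S"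

definition tiles_at :: "'a::euclidean_space set set \<Rightarrow> 'a \<Rightarrow> 'a set set" where
  "tiles_at \<T> v = {T \<in> \<T>. v extreme_point_of T}"

definition tiling_vertex :: "'a::euclidean_space set set \<Rightarrow> 'a \<Rightarrow> bool" where
  "tiling_vertex \<T> v \<longleftrightarrow> (\<exists>T\<in>\<T>. v extreme_point_of T)"

definition vec_angle :: "'a::euclidean_space \<Rightarrow> 'a \<Rightarrow> real" where
  "vec_angle x y = arccos ((x \<bullet> y) / (norm x * norm y))"

text \<open>The angle of the triangle \<open>T\<close> at its vertex \<open>v\<close>; it does not depend on the order of the
  other two vertices, see \<open>tile_angle_eq\<close> below. It is unspecified if \<open>v\<close> is not a vertex.\<close>

definition tile_angle :: "'a::euclidean_space set \<Rightarrow> 'a \<Rightarrow> real" where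
  "tile_angle T v = (THE \<theta>. \<exists>q r. {x. x extreme_point_of T} = {v, q, r} \<and>
     \<theta> = vec_angle (q - v) (r - v))"

lemma tile_angle_eq:
  assumes "{x. x extreme_point_of T} = {v, q, r}" and "distinct [v, q, r]"
  shows "tile_angle T v = vec_angle (q - v) (r - v)"
  unfolding tile_angle_def assms(1)
proof (rule the_equality)
  show "\<exists>q' r'. {v, q, r} = {v, q', r'} \<and>
      vec_angle (q - v) (r - v) = vec_angle (q' - v) (r' - v)"
    by (rule exI[of _ q], rule exI[of _ r]) simp
next
  fix \<theta>
  assume "\<exists>q' r'. {v, q, r} = {v, q', r'} \<and> \<theta> = vec_angle (q' - v) (r' - v)"
  then obtain q' r' where eq: "{v, q, r} = {v, q', r'}" and \<theta>: "\<theta> = vec_angle (q' - v) (r' - v)"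
    by (elim exE conjE)
  have "q \<in> {v, q', r'}" "r \<in> {v, q', r'}"
    unfolding eq[symmetric] by simp_all
  then have "(q' = q \<and> r' = r) \<or> (q' = r \<and> r' = q)"
    using assms(2) by auto
  then show "\<theta> = vec_angle (q - v) (r - v)"
    unfolding \<theta> vec_angle_def by (elim disjE conjE) (simp_all add: inner_commute mult.commute)
qed

definition boundary_vertex ::
  "'a::euclidean_space set set \<Rightarrow> 'a \<Rightarrow> 'a \<Rightarrow> 'a \<Rightarrow> 'a \<Rightarrow> bool" where
  "boundary_vertex \<T> A B C v \<longleftrightarrow> tiling_vertex \<T> v \<and> v \<notin> {A, B, C} \<and>
     (v \<in> frontier (convex hull {A, B, C}) \<or>
      (\<exists>T\<in>\<T>. \<exists>e. e edge_of T \<and> v \<in> rel_interior e))"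

definition interior_vertex ::
  "'a::euclidean_space set set \<Rightarrow> 'a \<Rightarrow> 'a \<Rightarrow> 'a \<Rightarrow> 'a \<Rightarrow> bool" where
  "interior_vertex \<T> A B C v \<longleftrightarrow> tiling_vertex \<T> v \<and> v \<notin> {A, B, C} \<and>
     (\<Sum>T\<in>tiles_at \<T> v. tile_angle T v) = 2 * pi"

definition share_segment :: "'a::euclidean_space set \<Rightarrow> 'a set \<Rightarrow> bool" where
  "share_segment T U \<longleftrightarrow> (\<exists>p q. p \<noteq> q \<and> closed_segment p q \<subseteq> frontier T \<inter> frontier U)"

text \<open>A coloring is given by the predicate selecting the black tiles; the other tiles are white.\<close>

definition proper_coloring ::
  "'a::euclidean_space set set \<Rightarrow> 'a \<Rightarrow> ('a set \<Rightarrow> bool) \<Rightarrow> bool" where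
  "proper_coloring \<T> A black \<longleftrightarrow>
     (\<forall>T\<in>\<T>. \<forall>U\<in>\<T>. T \<noteq> U \<and> share_segment T U \<longrightarrow> black T \<noteq> black U) \<and>
     (\<forall>T\<in>tiles_at \<T> A. black T)"

definition coloring_number :: "'a set set \<Rightarrow> ('a set \<Rightarrow> bool) \<Rightarrow> int" where
  "coloring_number \<T> black = int (card {T \<in> \<T>. black T}) - int (card {T \<in> \<T>. \<not> black T})"

end

theory Submission
  imports Defs
begin

text \<open>
  Sweep the triangle with lines parallel to the direction joining \<open>A\<close> to a generic point of \<open>BC\<close>,
  so that no two vertices lie on the same line. The tiles met by a line that avoids the vertices are
  linearly ordered along it, and neighbours share a segment; hence in a proper coloring the colors
  alternate along the line. While the line moves, the tiles it meets change only at a vertex \<open>v\<close>, where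
  those having their last point at \<open>v\<close> are replaced by those having their first point there. The
  parity conditions say exactly that the number of tiles of these two kinds together is even
  (at \<open>v\<close> two further tiles continue across the line if the angles sum to \<open>2\<pi>\<close>, and one if they sum to
  \<open>\<pi>\<close>), so the parity of the number of tiles above a given tile is independent of the line. Coloring
  a tile by this parity is proper, and it is the only proper coloring with a black tile at \<open>A\<close>.

  The signed sum of the perimeters is the integral over all lines of the signed sum of the length
  densities of the tile sides crossed. It telescopes: each inner crossing is counted
  once for a black and once for a white tile, and only the sides of \<open>ABC\<close> survive. The lowest tile
  touches \<open>BC\<close>; its color is the parity of the number of tiles on a line near \<open>B\<close>, i.e. of the tiles at
  \<open>B\<close>.
\<close>

section \<open>Angles around a point\<close>

text \<open>Lines are used instead of an adjacency graph because the tiling need not be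
  edge-to-edge: neighbours may share only part of a side, and a vertex of one tile may lie inside a
  side of another. A generic direction also excludes sides parallel to the lines, so each tile is
  the region between two piecewise affine graphs over the sweep parameter. A line through a vertex
  does not cross the tiles that begin or end there, so its counts are exceptional. Parities are
  compared only between lines that avoid all vertices, and the point is that both sides of a vertex
  line give the same value. No tile need cross all lines, so the agreement of an arbitrary proper
  coloring with the parity is carried from line to line, beginning near \<open>A\<close>. Boundary
  vertices are defined by position, interior vertices by the angle sum 2 pi. Before the evenness
  hypothesis can be applied, an angle sum has to be derived from the position of the tiles; this is
  why angles are first expressed as measures of sets of directions.\<close>

lemma sin_nonneg_both:
  fixes x \<theta> :: real
  assumes "0 \<le> x" "x < 2 * pi" "0 < \<theta>" "\<theta> < pi"
  shows "0 \<le> sin x \<and> 0 \<le> sin (\<theta> - x) \<longleftrightarrow> x \<le> \<theta>"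
proof
  assume "x \<le> \<theta>"
  then show "0 \<le> sin x \<and> 0 \<le> sin (\<theta> - x)"
    using assms by (auto intro!: sin_ge_zero)
next
  assume *: "0 \<le> sin x \<and> 0 \<le> sin (\<theta> - x)"
  show "x \<le> \<theta>"
  proof (rule ccontr)
    assume "\<not> x \<le> \<theta>"
    have "x \<le> pi"
    proof (rule ccontr)
      assume "\<not> x \<le> pi"
      then have "sin x < 0" using assms by (intro sin_lt_zero) auto
      then show False using * by simp
    qed
    then have "0 < sin (x - \<theta>)" using assms \<open>\<not> x \<le> \<theta>\<close> by (intro sin_gt_zero) auto
    then show False using * sin_minus[of "x - \<theta>"] by simp
  qed
qed

text \<open>Cramer's rule: \<open>Im (cnj a * b)\<close> is the determinant of the pair, so lying in
  the cone of \<open>a\<close> and \<open>b\<close> becomes a sign condition on two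
  determinants.\<close>

lemma cone_iff_Im:
  fixes a b w :: complex
  assumes "Im (cnj a * b) > 0"
  shows "w = s *\<^sub>R a + t *\<^sub>R b \<longleftrightarrow> Im (cnj w * b) = s * Im (cnj a * b) \<and> Im (cnj a * w) = t * Im (cnj a * b)"
proof
  assume "w = s *\<^sub>R a + t *\<^sub>R b"
  then show "Im (cnj w * b) = s * Im (cnj a * b) \<and> Im (cnj a * w) = t * Im (cnj a * b)"
    by (simp add: algebra_simps)
next
  define D where "D = Im (cnj a * b)"
  assume *: "Im (cnj w * b) = s * Im (cnj a * b) \<and> Im (cnj a * w) = t * Im (cnj a * b)"
  have "D * Re w = Im (cnj w * b) * Re a + Im (cnj a * w) * Re b"
    "D * Im w = Im (cnj w * b) * Im a + Im (cnj a * w) * Im b"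
    by (simp_all add: D_def algebra_simps)
  then have "D * Re w = D * (s * Re a + t * Re b)" "D * Im w = D * (s * Im a + t * Im b)"
    using * unfolding D_def by (simp_all only:) (simp_all add: algebra_simps)
  then show "w = s *\<^sub>R a + t *\<^sub>R b" using assms by (simp add: complex_eq_iff D_def)
qed

text \<open>Polar angles of the rays from \<open>v\<close> that meet \<open>T\<close> at a positive
  distance. With exactly one half-open period, the angle at a vertex is a Lebesgue measure and the
  full angle is an interval of length 2 pi, so additivity of angles becomes additivity of
  measure.\<close>

definition directions :: "complex set \<Rightarrow> complex \<Rightarrow> real set" where
  "directions T v = {\<phi> \<in> {0..<2 * pi}. \<exists>\<epsilon>>0. v + \<epsilon> *\<^sub>R cis \<phi> \<in> T}"

lemma Im_cnj_mult_rcis: "Im (cnj (rcis r x) * rcis s y) = r * s * sin (y - x)"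
  by (simp add: sin_diff algebra_simps)

text \<open>The directions fill the sector between the arguments of the two sides. The last two
  claims concern all sufficiently small distances, so that claims about two tiles can be combined at
  one distance. The finite \<open>K\<close> contains the rays along the sides, which never enter the
  interior.\<close>

lemma triangle_directions_oriented:
  assumes or: "Im (cnj (q - v) * (r - v)) > 0" and T: "T = convex hull {v, q, r}"
  shows "directions T v \<in> lmeasurable \<and>
    measure lebesgue (directions T v) = vec_angle (q - v) (r - v) \<and>
    (\<exists>K. finite K \<and> (\<forall>\<phi>\<in>directions T v - K. \<forall>\<^sub>F \<epsilon> in at_right 0. v + \<epsilon> *\<^sub>R cis \<phi> \<in> interior T)) \<and>
    (\<forall>\<phi>\<in>directions T v. \<forall>\<^sub>F \<epsilon> in at_right 0. v + \<epsilon> *\<^sub>R cis \<phi> \<in> T)"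
proof -
  define a b where "a = q - v" and "b = r - v"
  define \<alpha> \<rho> \<sigma> where "\<alpha> = Arg2pi a" and "\<rho> = norm a" and "\<sigma> = norm b"
  define \<theta> where "\<theta> = Arg (b / a)"
  have D: "Im (cnj a * b) > 0" using or by (simp add: a_def b_def)
  then have nz: "a \<noteq> 0" "b \<noteq> 0" by auto
  then have pos: "\<rho> > 0" "\<sigma> > 0" by (auto simp: \<rho>_def \<sigma>_def)
  have "Im (b / a) = Im (cnj a * b) / (norm a)\<^sup>2"
    by (simp add: complex_div_cnj[of b a] Im_divide_of_real mult.commute flip: of_real_power)
  then have "Im (b / a) > 0" using D nz by simp
  then have \<theta>: "0 < \<theta>" "\<theta> < pi"
    using Arg_lt_pi[of "b / a"] by (auto simp: \<theta>_def)
  have \<alpha>: "0 \<le> \<alpha>" "\<alpha> < 2 * pi" by (auto simp: \<alpha>_def Arg2pi_ge_0 Arg2pi_lt_2pi)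
  have a: "a = rcis \<rho> \<alpha>"
    using Arg2pi_eq[of a] by (simp add: rcis_def \<rho>_def \<alpha>_def cis_conv_exp)
  have "b = a * (b / a)" using nz by simp
  also have "\<dots> = rcis \<rho> \<alpha> * rcis (norm (b / a)) \<theta>"
    by (simp only: a[symmetric]) (simp add: \<theta>_def rcis_cmod_Arg)
  also have "\<dots> = rcis \<sigma> (\<alpha> + \<theta>)"
    using nz by (simp add: rcis_mult \<rho>_def \<sigma>_def norm_divide)
  finally have b: "b = rcis \<sigma> (\<alpha> + \<theta>)" .
  have "a \<bullet> b = \<rho> * \<sigma> * cos \<theta>"
    using cos_diff[of "\<alpha> + \<theta>" \<alpha>] by (simp add: a b inner_complex_def algebra_simps)
  moreover have "norm a = \<rho>" "norm b = \<sigma>" by (simp_all add: \<rho>_def \<sigma>_def)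
  ultimately have angle: "vec_angle a b = \<theta>"
    using pos \<theta> by (simp add: vec_angle_def arccos_cos)

  \<comment> \<open>If the sector reaches the polar angle 2 pi, its tail reappears at 0; the last
    disjunct is this tail and is empty if the sector does not wrap around.\<close>
  define I where "I = {\<phi>\<in>{0..<2 * pi}. (\<alpha> \<le> \<phi> \<and> \<phi> \<le> \<alpha> + \<theta>) \<or> \<phi> \<le> \<alpha> + \<theta> - 2 * pi}"
  define K where "K = {\<alpha>, \<alpha> + \<theta>, \<alpha> + \<theta> - 2 * pi}"
  have Im1: "Im (cnj a * cis \<phi>) = \<rho> * sin (\<phi> - \<alpha>)" for \<phi>
    using Im_cnj_mult_rcis[of \<rho> \<alpha> 1 \<phi>] by (simp add: a)
  have Im2: "Im (cnj (cis \<phi>) * b) = \<sigma> * sin (\<alpha> + \<theta> - \<phi>)" for \<phi>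
    using Im_cnj_mult_rcis[of 1 \<phi> \<sigma> "\<alpha> + \<theta>"] by (simp add: b)
  have mem_I: "\<phi> \<in> I \<longleftrightarrow> 0 \<le> Im (cnj a * cis \<phi>) \<and> 0 \<le> Im (cnj (cis \<phi>) * b)"
    if "\<phi> \<in> {0..<2 * pi}" for \<phi>
  proof (cases "\<alpha> \<le> \<phi>")
    case True
    have "\<phi> \<in> I \<longleftrightarrow> \<phi> - \<alpha> \<le> \<theta>" using True that \<theta> \<alpha> by (auto simp: I_def)
    also have "\<dots> \<longleftrightarrow> 0 \<le> sin (\<phi> - \<alpha>) \<and> 0 \<le> sin (\<theta> - (\<phi> - \<alpha>))"
      using True that \<theta> \<alpha> by (intro sin_nonneg_both[symmetric]) auto
    finally show ?thesis using pos unfolding Im1 Im2 by (simp add: zero_le_mult_iff algebra_simps)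
  next
    case False
    \<comment> \<open>Below \<open>\<alpha>\<close> the difference is shifted by one period into the
      range of \<open>sin_nonneg_both\<close>.\<close>
    have "\<phi> \<in> I \<longleftrightarrow> \<phi> - \<alpha> + 2 * pi \<le> \<theta>" using False that \<theta> \<alpha> by (auto simp: I_def)
    also have "\<dots> \<longleftrightarrow> 0 \<le> sin (\<phi> - \<alpha> + 2 * pi) \<and> 0 \<le> sin (\<theta> - (\<phi> - \<alpha> + 2 * pi))"
      using False that \<theta> \<alpha> by (intro sin_nonneg_both[symmetric]) auto
    also have "sin (\<theta> - (\<phi> - \<alpha> + 2 * pi)) = sin (\<alpha> + \<theta> - \<phi>)"
      using sin_periodic[of "\<theta> - (\<phi> - \<alpha> + 2 * pi)"] by (simp add: algebra_simps)
    finally show ?thesis using pos unfolding Im1 Im2 by (simp add: zero_le_mult_iff)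
  qed
  have strict_I: "0 < Im (cnj a * cis \<phi>) \<and> 0 < Im (cnj (cis \<phi>) * b)" if "\<phi> \<in> I - K" for \<phi>
  proof (cases "\<alpha> \<le> \<phi>")
    case True
    then have "0 < sin (\<phi> - \<alpha>)" "0 < sin (\<alpha> + \<theta> - \<phi>)"
      using that \<theta> \<alpha> by (auto simp: I_def K_def intro!: sin_gt_zero)
    then show ?thesis using pos unfolding Im1 Im2 by simp
  next
    case False
    then have "0 \<le> \<phi>" "\<phi> < \<alpha> + \<theta> - 2 * pi" using that by (auto simp: I_def K_def)
    then have "0 < sin (\<phi> - \<alpha> + 2 * pi)" "0 < sin (\<alpha> + \<theta> - \<phi> - 2 * pi)"
      using \<theta> \<alpha> by (intro sin_gt_zero; linarith)+
    then show ?thesis using pos sin_periodic[of "\<alpha> + \<theta> - \<phi> - 2 * pi"] unfolding Im1 Im2 by simp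
  qed

  have combo: "v + \<epsilon> *\<^sub>R (s *\<^sub>R a + t *\<^sub>R b) =
      (1 - \<epsilon> * s - \<epsilon> * t) *\<^sub>R v + (\<epsilon> * s) *\<^sub>R q + (\<epsilon> * t) *\<^sub>R r" for \<epsilon> s t
    by (simp add: a_def b_def algebra_simps)
  have small: "\<forall>\<^sub>F \<epsilon> in at_right 0. 0 < \<epsilon> \<and> 0 < 1 - \<epsilon> * s - \<epsilon> * t" for s t :: real
  proof -
    have "((\<lambda>\<epsilon>. 1 - \<epsilon> * s - \<epsilon> * t) \<longlongrightarrow> 1 - 0 * s - 0 * t) (at_right 0)"
      by (intro tendsto_intros)
    then have "\<forall>\<^sub>F \<epsilon> in at_right 0. 0 < 1 - \<epsilon> * s - \<epsilon> * t"
      by (rule order_tendstoD) simp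
    then show ?thesis
      using eventually_at_right_less[of "0::real"] by eventually_elim simp
  qed
  have in_T: "\<forall>\<^sub>F \<epsilon> in at_right 0. v + \<epsilon> *\<^sub>R cis \<phi> \<in> T"
    if "\<phi> \<in> I" for \<phi>
  proof -
    define s t where "s = Im (cnj (cis \<phi>) * b) / Im (cnj a * b)"
      and "t = Im (cnj a * cis \<phi>) / Im (cnj a * b)"
    have st: "0 \<le> s" "0 \<le> t"
      using mem_I[of \<phi>] that D by (auto simp: s_def t_def I_def)
    have eq: "cis \<phi> = s *\<^sub>R a + t *\<^sub>R b"
      using D by (subst cone_iff_Im[OF D]) (simp add: s_def t_def)
    show ?thesis using small[of s t]
    proof eventually_elim
      case (elim \<epsilon>)
      then show ?case unfolding eq combo T convex_hull_3 using st
        by (intro CollectI exI[of _ "1 - \<epsilon> * s - \<epsilon> * t"] exI[of _ "\<epsilon> * s"] exI[of _ "\<epsilon> * t"]) auto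
    qed
  qed
  have ncol: "\<not> collinear {v, q, r}"
  proof
    assume "collinear {v, q, r}"
    then have "collinear {q, v, r}" by (simp add: insert_commute)
    then have "collinear {0, a, b}" by (simp add: collinear_3 a_def b_def)
    then have "b / a \<in> \<real>" using collinear_iff_Reals by blast
    then show False using \<open>Im (b / a) > 0\<close> by (auto simp: complex_is_Real_iff)
  qed
  have in_interior: "\<forall>\<^sub>F \<epsilon> in at_right 0. v + \<epsilon> *\<^sub>R cis \<phi> \<in> interior T"
    if "\<phi> \<in> I - K" for \<phi>
  proof -
    define s t where "s = Im (cnj (cis \<phi>) * b) / Im (cnj a * b)"
      and "t = Im (cnj a * cis \<phi>) / Im (cnj a * b)"
    have st: "0 < s" "0 < t"
      using strict_I[of \<phi>] that D by (auto simp: s_def t_def I_def)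
    have eq: "cis \<phi> = s *\<^sub>R a + t *\<^sub>R b"
      using D by (subst cone_iff_Im[OF D]) (simp add: s_def t_def)
    have int: "interior T = {w. \<exists>x y z. 0 < x \<and> 0 < y \<and> 0 < z \<and> x + y + z = 1 \<and>
        x *\<^sub>R v + y *\<^sub>R q + z *\<^sub>R r = w}"
      unfolding T by (rule interior_convex_hull_3_minimal[OF ncol]) simp
    show ?thesis using small[of s t]
    proof eventually_elim
      case (elim \<epsilon>)
      then show ?case unfolding eq combo int using st
        by (intro CollectI exI[of _ "1 - \<epsilon> * s - \<epsilon> * t"] exI[of _ "\<epsilon> * s"] exI[of _ "\<epsilon> * t"]) auto
    qed
  qed
  have "directions T v = I"
  proof (intro equalityI subsetI)
    fix \<phi> assume "\<phi> \<in> directions T v"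
    then obtain \<epsilon> where \<phi>: "\<phi> \<in> {0..<2 * pi}" and "\<epsilon> > 0" "v + \<epsilon> *\<^sub>R cis \<phi> \<in> T"
      by (auto simp: directions_def)
    then obtain x y z where xyz: "0 \<le> x" "0 \<le> y" "0 \<le> z" "x + y + z = 1"
      "v + \<epsilon> *\<^sub>R cis \<phi> = x *\<^sub>R v + y *\<^sub>R q + z *\<^sub>R r"
      unfolding T convex_hull_3 by blast
    have x: "x = 1 - y - z" using xyz(4) by simp
    have "\<epsilon> *\<^sub>R cis \<phi> = y *\<^sub>R a + z *\<^sub>R b"
      using xyz(5) unfolding x by (simp add: a_def b_def algebra_simps)
    then have "(1 / \<epsilon>) *\<^sub>R \<epsilon> *\<^sub>R cis \<phi> = (1 / \<epsilon>) *\<^sub>R (y *\<^sub>R a + z *\<^sub>R b)"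
      by simp
    then have "cis \<phi> = (y / \<epsilon>) *\<^sub>R a + (z / \<epsilon>) *\<^sub>R b"
      using \<open>\<epsilon> > 0\<close> by (simp add: scaleR_add_right)
    then have "Im (cnj (cis \<phi>) * b) = y / \<epsilon> * Im (cnj a * b) \<and>
        Im (cnj a * cis \<phi>) = z / \<epsilon> * Im (cnj a * b)"
      by (rule cone_iff_Im[OF D, THEN iffD1])
    then show "\<phi> \<in> I" unfolding mem_I[OF \<phi>] using D xyz(2,3) \<open>\<epsilon> > 0\<close> by (simp del: cnj.simps times_complex.simps)
  next
    fix \<phi> assume "\<phi> \<in> I"
    then have "\<forall>\<^sub>F \<epsilon> in at_right 0. v + \<epsilon> *\<^sub>R cis \<phi> \<in> T \<and> (0::real) < \<epsilon>"
      using in_T eventually_at_right_less[of "0::real"] by (intro eventually_conj)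
    then obtain \<epsilon> :: real where "v + \<epsilon> *\<^sub>R cis \<phi> \<in> T \<and> 0 < \<epsilon>"
      using eventually_happens'[of "at_right (0::real)"] trivial_limit_at_right_real by blast
    then show "\<phi> \<in> directions T v" using \<open>\<phi> \<in> I\<close> by (auto simp: directions_def I_def)
  qed
  moreover have "I \<in> lmeasurable \<and> measure lebesgue I = \<theta>"
  proof (cases "\<alpha> + \<theta> < 2 * pi")
    case True
    then have "I = {\<alpha>..\<alpha> + \<theta>}" using \<alpha> \<theta> by (auto simp: I_def)
    then show ?thesis using \<theta> by simp
  next
    case False
    then have I: "I = {0..\<alpha> + \<theta> - 2 * pi} \<union> {\<alpha>..<2 * pi}" using \<alpha> \<theta> by (auto simp: I_def)
    have 1: "{\<alpha>..<2 * pi} \<in> lmeasurable"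
      by (rule bounded_set_imp_lmeasurable) auto
    have "{\<alpha>..<2 * pi} - {0..\<alpha> + \<theta> - 2 * pi} = {\<alpha>..<2 * pi}" using \<theta> by auto
    then have 2: "measure lebesgue ({0..\<alpha> + \<theta> - 2 * pi} \<union> {\<alpha>..<2 * pi}) =
        measure lebesgue {0..\<alpha> + \<theta> - 2 * pi} + measure lebesgue {\<alpha>..<2 * pi}"
      using 1 by (subst measure_Un2) auto
    have "measure lebesgue {\<alpha>..<2 * pi} = 2 * pi - \<alpha>"
      using \<alpha> by (simp add: measure_completion)
    then show ?thesis using \<alpha> \<theta> False 1 2 by (auto simp: I)
  qed
  moreover have "finite K" by (simp add: K_def)
  ultimately show ?thesis
    using in_T in_interior angle by (auto simp: a_def b_def)
qed

lemma simplex_2E: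
  assumes "2 simplex (T :: complex set)"
  obtains p q r where "T = convex hull {p, q, r}" "\<not> collinear {p, q, r}"
    "\<And>x. x extreme_point_of T \<longleftrightarrow> x \<in> {p, q, r}"
proof -
  obtain C where C: "\<not> affine_dependent C" "int (card C) = 2 + 1" "T = convex hull C"
    using assms unfolding simplex_def by blast
  then have "card C = 3" by linarith
  then obtain p q r where pqr: "C = {p, q, r}" "p \<noteq> q" "q \<noteq> r" "p \<noteq> r"
    by (auto simp: card_3_iff)
  moreover have "\<not> collinear {p, q, r}"
    using C(1) pqr collinear_3_eq_affine_dependent by blast
  ultimately show thesis
    using that[of p q r] C extreme_point_of_convex_hull_affine_independent[OF C(1)] by blast
qed

lemma simplex_2_vertexE:
  assumes "2 simplex (T :: complex set)" "v extreme_point_of T"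
  obtains q r where "T = convex hull {v, q, r}" "\<not> collinear {v, q, r}"
    "{x. x extreme_point_of T} = {v, q, r}"
proof -
  obtain x y z where xyz: "T = convex hull {x, y, z}" "\<not> collinear {x, y, z}"
    "\<And>w. w extreme_point_of T \<longleftrightarrow> w \<in> {x, y, z}"
    using simplex_2E[OF assms(1)] by metis
  have "v = x \<or> v = y \<or> v = z" using xyz(3) assms(2) by auto
  moreover have "{y, x, z} = {x, y, z}" "{z, x, y} = {x, y, z}" by auto
  moreover have "{w. w extreme_point_of T} = {x, y, z}" using xyz(3) by auto
  ultimately show thesis using that xyz(1,2) by metis
qed

lemma simplex_2_closure_interior:
  assumes "2 simplex (T :: complex set)"
  shows "closure (interior T) = T" "interior T \<noteq> {}" "closed T" "convex T" "compact T"
proof -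
  obtain p q r where T: "T = convex hull {p, q, r}" "\<not> collinear {p, q, r}"
    using simplex_2E[OF assms] by metis
  then show T': "convex T" "compact T" by (auto simp: finite_imp_compact_convex_hull)
  then show "closed T" by (simp add: compact_imp_closed)
  have "(1/3) *\<^sub>R p + (1/3) *\<^sub>R q + (1/3) *\<^sub>R r \<in> interior T"
    unfolding T(1) interior_convex_hull_3_minimal[OF T(2), simplified]
    by (intro CollectI exI[of _ "1/3"] conjI) simp_all
  then show "interior T \<noteq> {}" by blast
  then show "closure (interior T) = T"
    using convex_closure_interior[of T] \<open>closed T\<close> T' by simp
qed

lemma simplex_2_interior_meets:
  assumes "2 simplex (T :: complex set)" "open W" "W \<inter> T \<noteq> {}"
  shows "W \<inter> interior T \<noteq> {}"
  using assms open_Int_closure_eq_empty[of W "interior T"] simplex_2_closure_interior(1)[OF assms(1)]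
  by simp

lemma finite_tiling_vertices:
  fixes \<T> :: "complex set set"
  assumes "finite \<T>" "\<And>T. T \<in> \<T> \<Longrightarrow> 2 simplex T"
  shows "finite {v. tiling_vertex \<T> v}"
proof -
  have "finite {x. x extreme_point_of T}" if "T \<in> \<T>" for T
  proof (rule simplex_2E[OF assms(2)[OF that]])
    fix p q r assume "\<And>x. x extreme_point_of T \<longleftrightarrow> x \<in> {p, q, r}"
    then have "{x. x extreme_point_of T} = {p, q, r}" by blast
    then show ?thesis by simp
  qed
  then have "finite (\<Union>T\<in>\<T>. {x. x extreme_point_of T})" using assms(1) by blast
  moreover have "{v. tiling_vertex \<T> v} = (\<Union>T\<in>\<T>. {x. x extreme_point_of T})"
    by (auto simp: tiling_vertex_def)
  ultimately show ?thesis by simp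
qed

text \<open>Exchanging the other two vertices negates the determinant, so one of the two orders is
  positively oriented, and the angle does not depend on the order.\<close>

lemma triangle_directions:
  assumes "2 simplex T" "v extreme_point_of T"
  shows "directions T v \<in> lmeasurable" (is ?L)
    "measure lebesgue (directions T v) = tile_angle T v" (is ?M)
    "\<exists>K. finite K \<and> (\<forall>\<phi>\<in>directions T v - K. \<forall>\<^sub>F \<epsilon> in at_right 0. v + \<epsilon> *\<^sub>R cis \<phi> \<in> interior T)" (is ?I)
    "\<And>\<phi>. \<phi> \<in> directions T v \<Longrightarrow> \<forall>\<^sub>F \<epsilon> in at_right 0. v + \<epsilon> *\<^sub>R cis \<phi> \<in> T" (is "PROP ?E")
proof -
  obtain q r where T: "T = convex hull {v, q, r}" "\<not> collinear {v, q, r}"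
    and ext: "{x. x extreme_point_of T} = {v, q, r}"
    using simplex_2_vertexE[OF assms] by metis
  have dist: "distinct [v, q, r]" using T(2) by (auto simp: insert_commute)
  have angle: "tile_angle T v = vec_angle (q - v) (r - v)" "tile_angle T v = vec_angle (r - v) (q - v)"
    using tile_angle_eq[OF ext dist] by (auto simp: vec_angle_def inner_commute mult.commute)
  have "Im (cnj (q - v) * (r - v)) \<noteq> 0"
  proof
    assume 0: "Im (cnj (q - v) * (r - v)) = 0"
    have "(r - v) / (q - v) \<in> \<real>"
      using 0 by (simp add: complex_is_Real_iff Im_divide algebra_simps)
    then have "collinear {0, q - v, r - v}" using collinear_iff_Reals by blast
    then have "collinear {q, v, r}" by (simp add: collinear_3)
    then show False using T(2) by (simp add: insert_commute)
  qed
  moreover have "Im (cnj (q - v) * (r - v)) = - Im (cnj (r - v) * (q - v))"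
    by (simp add: algebra_simps)
  ultimately consider "Im (cnj (q - v) * (r - v)) > 0" | "Im (cnj (r - v) * (q - v)) > 0"
    by linarith
  then have "?L \<and> ?M \<and> ?I \<and> (\<forall>\<phi>\<in>directions T v. \<forall>\<^sub>F \<epsilon> in at_right 0. v + \<epsilon> *\<^sub>R cis \<phi> \<in> T)"
  proof cases
    case 1
    show ?thesis using triangle_directions_oriented[OF 1 T(1)] angle(1) by metis
  next
    case 2
    have "T = convex hull {v, r, q}" using T(1) by (simp add: insert_commute)
    from triangle_directions_oriented[OF 2 this] show ?thesis using angle(2) by metis
  qed
  then show ?L ?M ?I "PROP ?E" by blast+
qed

text \<open>The direction sets of the tiles at \<open>v\<close> cover the full period and overlap in
  finitely many rays only. The hypothesis \<open>vertex\<close> excludes a tile with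
  \<open>v\<close> inside a side, which would cover a half-turn without contributing to the
  sum.\<close>

lemma angle_sum_around_point:
  fixes \<T> :: "complex set set"
  assumes fin: "finite \<T>" and simplex: "\<And>T. T \<in> \<T> \<Longrightarrow> 2 simplex T"
    and disj: "pairwise (\<lambda>T U. interior T \<inter> interior U = {}) \<T>"
    and v: "v \<in> interior (\<Union>\<T>)"
    and vertex: "\<And>T. T \<in> \<T> \<Longrightarrow> v \<in> T \<Longrightarrow> v extreme_point_of T"
  shows "(\<Sum>T\<in>tiles_at \<T> v. tile_angle T v) = 2 * pi"
proof -
  let ?D = "\<lambda>T. directions T v"
  have fin': "finite (tiles_at \<T> v)" using fin by (simp add: tiles_at_def)
  have at: "2 simplex T" "v extreme_point_of T" if "T \<in> tiles_at \<T> v" for T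
    using that simplex by (auto simp: tiles_at_def)
  have "(\<Union>T\<in>tiles_at \<T> v. ?D T) = {0..<2 * pi}"
  proof
    show "(\<Union>T\<in>tiles_at \<T> v. ?D T) \<subseteq> {0..<2 * pi}" by (auto simp: directions_def)
    show "{0..<2 * pi} \<subseteq> (\<Union>T\<in>tiles_at \<T> v. ?D T)"
    proof
      fix \<phi> :: real assume \<phi>: "\<phi> \<in> {0..<2 * pi}"
      have lim: "((\<lambda>\<epsilon>. v + \<epsilon> *\<^sub>R cis \<phi>) \<longlongrightarrow> v + 0 *\<^sub>R cis \<phi>) (at_right 0)"
        by (intro tendsto_intros)
      have near: "\<forall>\<^sub>F \<epsilon> in at_right 0. v + \<epsilon> *\<^sub>R cis \<phi> \<in> W" if "open W" "v \<in> W" for W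
        using topological_tendstoD[OF lim that(1)] that(2) by simp
      have 1: "\<forall>\<^sub>F \<epsilon> in at_right 0. v + \<epsilon> *\<^sub>R cis \<phi> \<in> interior (\<Union>\<T>)"
        by (rule near) (use v in auto)
      \<comment> \<open>The finitely many closed tiles that miss \<open>v\<close> also miss the ray
        close to \<open>v\<close>, so whatever covers the ray there has a vertex at
        \<open>v\<close>.\<close>
      have "\<forall>T\<in>\<T>. \<forall>\<^sub>F \<epsilon> in at_right 0. v \<notin> T \<longrightarrow> v + \<epsilon> *\<^sub>R cis \<phi> \<notin> T"
      proof
        fix T assume "T \<in> \<T>"
        show "\<forall>\<^sub>F \<epsilon> in at_right 0. v \<notin> T \<longrightarrow> v + \<epsilon> *\<^sub>R cis \<phi> \<notin> T"
        proof (cases "v \<in> T")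
          case False
          then show ?thesis
            using near[of "- T"] simplex_2_closure_interior(3)[OF simplex[OF \<open>T \<in> \<T>\<close>]]
            by (simp add: open_Compl)
        qed simp
      qed
      then have 2: "\<forall>\<^sub>F \<epsilon> in at_right 0. \<forall>T\<in>\<T>. v \<notin> T \<longrightarrow> v + \<epsilon> *\<^sub>R cis \<phi> \<notin> T"
        by (rule eventually_ball_finite[OF fin])
      have "\<forall>\<^sub>F \<epsilon> in at_right (0::real). \<exists>T\<in>tiles_at \<T> v. \<epsilon> > 0 \<and> v + \<epsilon> *\<^sub>R cis \<phi> \<in> T"
        using 1 2 eventually_at_right_less[of "0::real"]
      proof eventually_elim
        case (elim \<epsilon>)
        then obtain T where "T \<in> \<T>" "v + \<epsilon> *\<^sub>R cis \<phi> \<in> T" using interior_subset by blast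
        then show ?case using elim vertex[of T] by (auto simp: tiles_at_def)
      qed
      then obtain \<epsilon> :: real where "\<exists>T\<in>tiles_at \<T> v. \<epsilon> > 0 \<and> v + \<epsilon> *\<^sub>R cis \<phi> \<in> T"
        using eventually_happens'[of "at_right (0::real)"] trivial_limit_at_right_real by blast
      then show "\<phi> \<in> (\<Union>T\<in>tiles_at \<T> v. ?D T)" using \<phi> by (auto simp: directions_def)
    qed
  qed
  moreover have "measure lebesgue (\<Union>T\<in>tiles_at \<T> v. ?D T) = (\<Sum>T\<in>tiles_at \<T> v. measure lebesgue (?D T))"
  proof (rule measure_negligible_finite_Union_image[OF fin'])
    show "?D T \<in> lmeasurable" if "T \<in> tiles_at \<T> v" for T
      using triangle_directions(1) at[OF that] by blast
    show "pairwise (\<lambda>T U. negligible (?D T \<inter> ?D U)) (tiles_at \<T> v)"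
    proof (rule pairwiseI)
      fix T U assume TU: "T \<in> tiles_at \<T> v" "U \<in> tiles_at \<T> v" "T \<noteq> U"
      obtain K where K: "finite K" "\<And>\<phi>. \<phi> \<in> ?D T - K \<Longrightarrow>
          \<forall>\<^sub>F \<epsilon> in at_right 0. v + \<epsilon> *\<^sub>R cis \<phi> \<in> interior T"
        using triangle_directions(3)[OF at[OF TU(1)]] by blast
      \<comment> \<open>A common direction off the side rays of \<open>T\<close> would put points of
        \<open>U\<close> into the interior of \<open>T\<close>.\<close>
      have "?D T \<inter> ?D U \<subseteq> K"
      proof (rule ccontr)
        assume "\<not> ?D T \<inter> ?D U \<subseteq> K"
        then obtain \<phi> where \<phi>: "\<phi> \<in> ?D T - K" "\<phi> \<in> ?D U" by blast
        have "\<forall>\<^sub>F \<epsilon> in at_right 0. v + \<epsilon> *\<^sub>R cis \<phi> \<in> interior T \<and> v + \<epsilon> *\<^sub>R cis \<phi> \<in> U"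
          using K(2)[OF \<phi>(1)] triangle_directions(4)[OF at[OF TU(2)] \<phi>(2)]
          by (rule eventually_conj)
        then obtain \<epsilon> where "v + \<epsilon> *\<^sub>R cis \<phi> \<in> interior T \<and> v + \<epsilon> *\<^sub>R cis \<phi> \<in> U"
          using eventually_happens'[of "at_right (0::real)"] trivial_limit_at_right_real by blast
        then have "interior T \<inter> interior U \<noteq> {}"
          using simplex_2_interior_meets[of U "interior T"] at[OF TU(2)] by blast
        then show False using disj TU by (auto simp: pairwise_def tiles_at_def)
      qed
      then show "negligible (?D T \<inter> ?D U)"
        using K(1) finite_subset negligible_finite by blast
    qed
  qed
  moreover have "measure lebesgue (?D T) = tile_angle T v" if "T \<in> tiles_at \<T> v" for T
    using triangle_directions(2) at[OF that] by blast
  moreover have "measure lebesgue {0..<2 * pi} = 2 * pi" by (simp add: measure_completion)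
  ultimately show ?thesis by simp
qed

section \<open>Triangles in oblique coordinates\<close>

text \<open>The sweep lines are the level sets of \<open>u\<close>; \<open>h\<close> is the position
  along them in direction \<open>d\<close>. The coordinates are kept abstract so that the locale can
  be instantiated a second time with heights negated.\<close>

locale coords =
  fixes u h :: "complex \<Rightarrow> real" and E d :: complex
  assumes lin_u: "linear u" and lin_h: "linear h"
    and coord: "\<And>z. z = u z *\<^sub>R E + h z *\<^sub>R d"
    and basis: "u E = 1" "u d = 0" "h E = 0" "h d = 1"
begin

definition pt :: "real \<Rightarrow> real \<Rightarrow> complex" where
  "pt s y = s *\<^sub>R E + y *\<^sub>R d"

definition hi :: "complex set \<Rightarrow> real \<Rightarrow> real" where
  "hi T s = Sup {y. pt s y \<in> T}"

definition lo :: "complex set \<Rightarrow> real \<Rightarrow> real" where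
  "lo T s = Inf {y. pt s y \<in> T}"

definition slope :: "complex \<Rightarrow> complex \<Rightarrow> real" where
  "slope p q = (h q - h p) / (u q - u p)"

definition chord :: "complex \<Rightarrow> complex \<Rightarrow> real \<Rightarrow> real" where
  "chord p q s = h p + slope p q * (s - u p)"

text \<open>The length element of the graph of \<open>f\<close>: the norm of the derivative of
  \<open>pt s (f s)\<close> in \<open>s\<close>. At a bend \<open>deriv\<close> is arbitrary, so
  \<open>dens\<close> is evaluated at points of local affinity or under an integral that ignores
  finitely many points.\<close>

definition dens :: "(real \<Rightarrow> real) \<Rightarrow> real \<Rightarrow> real" where
  "dens f s = norm (E + deriv f s *\<^sub>R d)"

text \<open>Stronger than differentiability on purpose: two such functions that touch without
  crossing coincide on a whole neighbourhood, see \<open>touching\<close>.\<close>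

definition locally_affine :: "(real \<Rightarrow> real) \<Rightarrow> real \<Rightarrow> bool" where
  "locally_affine f s \<longleftrightarrow> (\<exists>m. \<forall>\<^sub>F t in nhds s. f t = f s + m * (t - s))"

lemma u_pt [simp]: "u (pt s y) = s"
  unfolding pt_def by (simp add: linear_add[OF lin_u] linear_scale[OF lin_u] basis)

lemma h_pt [simp]: "h (pt s y) = y"
  unfolding pt_def by (simp add: linear_add[OF lin_h] linear_scale[OF lin_h] basis)

lemma pt_uh [simp]: "pt (u z) (h z) = z"
  unfolding pt_def using coord[of z] by simp

lemma u_comb: "u (a *\<^sub>R p + b *\<^sub>R q) = a * u p + b * u q"
  by (simp only: linear_add[OF lin_u] linear_scale[OF lin_u] real_scaleR_def)

lemma h_comb: "h (a *\<^sub>R p + b *\<^sub>R q) = a * h p + b * h q"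
  by (simp only: linear_add[OF lin_h] linear_scale[OF lin_h] real_scaleR_def)

lemma coords_eqI: "u z = u w \<Longrightarrow> h z = h w \<Longrightarrow> z = w"
  by (metis pt_uh)

lemma tendsto_u [tendsto_intros]: "(f \<longlongrightarrow> l) F \<Longrightarrow> ((\<lambda>x. u (f x)) \<longlongrightarrow> u l) F"
  using bounded_linear.tendsto[of u f l F] lin_u by (simp add: linear_conv_bounded_linear)

lemma tendsto_h [tendsto_intros]: "(f \<longlongrightarrow> l) F \<Longrightarrow> ((\<lambda>x. h (f x)) \<longlongrightarrow> h l) F"
  using bounded_linear.tendsto[of h f l F] lin_h by (simp add: linear_conv_bounded_linear)

text \<open>Turning the picture upside down exchanges \<open>hi\<close> and \<open>lo\<close> up to
  sign. Facts about lower boundaries and about triangles pointing down are obtained this way from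
  the upper ones.\<close>

lemma reflected: "coords u (\<lambda>z. - h z) E (- d)"
proof (rule coords.intro)
  show "linear (\<lambda>z. - h z)" by (rule linear_compose_neg[OF lin_h])
  show "z = u z *\<^sub>R E + - h z *\<^sub>R - d" for z using coord[of z] by simp
qed (simp_all add: lin_u basis linear_neg[OF lin_u] linear_neg[OF lin_h])

lemma convex_affine_ineq: "convex {z. c \<le> k * u z + l * h z}"
proof -
  have "linear (\<lambda>z. k * u z + l * h z)"
    by (rule linearI) (simp_all add: linear_add[OF lin_u] linear_add[OF lin_h]
        linear_scale[OF lin_u] linear_scale[OF lin_h] algebra_simps)
  then have "convex ((\<lambda>z. k * u z + l * h z) -` {c..})"
    by (rule convex_linear_vimage) simp
  then show ?thesis by (simp add: vimage_def)
qed

lemma chord_left [simp]: "chord p q (u p) = h p"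
  by (simp add: chord_def)

lemma chord_right [simp]: "u p \<noteq> u q \<Longrightarrow> chord p q (u q) = h q"
  by (simp add: chord_def slope_def)

lemma chord_alt: "u p \<noteq> u q \<Longrightarrow> chord p q s = h q + slope p q * (s - u q)"
  by (simp add: chord_def slope_def field_simps)

lemma chord_shift: "chord p q t = chord p q s + slope p q * (t - s)"
  by (simp add: chord_def algebra_simps)

lemma pt_chord:
  assumes "u p < u q"
  defines "t \<equiv> \<lambda>s. (s - u p) / (u q - u p)"
  shows "pt s (chord p q s) = (1 - t s) *\<^sub>R p + t s *\<^sub>R q"
proof (rule coords_eqI)
  show "u (pt s (chord p q s)) = u ((1 - t s) *\<^sub>R p + t s *\<^sub>R q)"
  proof -
    have "t s * (u q - u p) = s - u p" using assms by simp
    then show ?thesis unfolding u_comb by (simp add: algebra_simps)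
  qed
  show "h (pt s (chord p q s)) = h ((1 - t s) *\<^sub>R p + t s *\<^sub>R q)"
  proof -
    have "chord p q s = h p + t s * (h q - h p)" by (simp add: chord_def slope_def t_def)
    then show ?thesis unfolding h_comb by (simp add: algebra_simps)
  qed
qed

lemma pt_chord_closed_segment:
  assumes "u p < u q" "u p \<le> s" "s \<le> u q"
  shows "pt s (chord p q s) \<in> closed_segment p q"
  unfolding in_segment using assms
  by (intro exI[of _ "(s - u p) / (u q - u p)"]) (simp add: pt_chord)

lemma pt_chord_open_segment:
  assumes "u p < u q" "u p < s" "s < u q"
  shows "pt s (chord p q s) \<in> open_segment p q"
  unfolding in_segment using assms
  by (intro conjI exI[of _ "(s - u p) / (u q - u p)"]) (auto simp add: pt_chord)

lemma pt_convex_comb: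
  "pt s ((1 - t) * y + t * y') = (1 - t) *\<^sub>R pt s y + t *\<^sub>R pt s y'"
  by (simp add: pt_def algebra_simps)

text \<open>Parametrized by \<open>u\<close>, the segment has the constant velocity (q - p) / (u q -
  u p).\<close>

lemma dens_chord:
  assumes "u p < u q" "\<forall>\<^sub>F t in nhds s. f t = chord p q t"
  shows "dens f s = dist p q / (u q - u p)"
proof -
  have "(chord p q has_real_derivative slope p q) (at s)"
    unfolding chord_def by (auto intro!: derivative_eq_intros)
  then have "(f has_real_derivative slope p q) (at s)"
    using DERIV_cong_ev[OF refl assms(2) refl] by blast
  then have "dens f s = norm (E + slope p q *\<^sub>R d)"
    by (simp add: dens_def DERIV_imp_deriv)
  also have "\<dots> = norm ((1 / (u q - u p)) *\<^sub>R (q - p))"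
  proof -
    have "E + slope p q *\<^sub>R d = (1 / (u q - u p)) *\<^sub>R (q - p)"
    proof (rule coords_eqI)
      show "u (E + slope p q *\<^sub>R d) = u ((1 / (u q - u p)) *\<^sub>R (q - p))" using assms(1)
        by (simp add: linear_add[OF lin_u] linear_scale[OF lin_u] linear_diff[OF lin_u] basis
            del: scaleR_right_diff_distrib)
      show "h (E + slope p q *\<^sub>R d) = h ((1 / (u q - u p)) *\<^sub>R (q - p))" using assms(1)
        by (simp add: linear_add[OF lin_h] linear_scale[OF lin_h] linear_diff[OF lin_h] basis slope_def
            del: scaleR_right_diff_distrib)
    qed
    then show ?thesis by simp
  qed
  also have "\<dots> = dist p q / (u q - u p)"
    using assms(1) by (simp add: dist_norm norm_minus_commute del: scaleR_right_diff_distrib)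
  finally show ?thesis .
qed

lemma dens_has_integral:
  assumes "u p < u q" "\<And>s. u p < s \<Longrightarrow> s < u q \<Longrightarrow> f s = chord p q s"
  shows "(dens f has_integral dist p q) {u p..u q}"
proof -
  have "((\<lambda>s. dist p q / (u q - u p)) has_integral dist p q) (cbox (u p) (u q))"
    using has_integral_const_real[of "dist p q / (u q - u p)" "u p" "u q"] assms(1) by simp
  moreover have "dens f s = dist p q / (u q - u p)" if "s \<in> box (u p) (u q)" for s
  proof (rule dens_chord[OF assms(1)])
    have "s \<in> {u p<..<u q}" using that by simp
    then have "\<forall>\<^sub>F t in nhds s. t \<in> {u p<..<u q}"
      by (intro eventually_nhds_in_open) auto
    then show "\<forall>\<^sub>F t in nhds s. f t = chord p q t"
      by eventually_elim (simp add: assms(2))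
  qed
  ultimately have "(dens f has_integral dist p q) (cbox (u p) (u q))"
    by (rule has_integral_spike_interior)
  then show ?thesis by simp
qed

lemma convex_slice:
  assumes "convex T" "pt s y \<in> T" "pt s y' \<in> T" "y \<le> x" "x \<le> y'"
  shows "pt s x \<in> T"
proof (cases "y = y'")
  case True then show ?thesis using assms by simp
next
  case False
  define t where "t = (x - y) / (y' - y)"
  have "x = (1 - t) * y + t * y'"
  proof -
    have "t * (y' - y) = x - y" using False by (simp add: t_def)
    then show ?thesis by (simp add: algebra_simps)
  qed
  moreover have "0 \<le> t" "t \<le> 1" using assms False by (auto simp: t_def)
  ultimately show ?thesis using assms(1-3) unfolding convex_alt by (metis pt_convex_comb)
qed

end

text \<open>The strict order of the vertices is what a generic direction supplies; the boundary
  graphs can then bend only at the middle vertex \<open>q\<close>.\<close>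

locale sorted_triangle = coords +
  fixes p q r :: complex
  assumes order: "u p < u q" "u q < u r" and noncollinear: "\<not> collinear {p, q, r}"
begin

abbreviation "T \<equiv> convex hull {p, q, r}"

lemma affine_independent: "\<not> affine_dependent {p, q, r}"
  using noncollinear collinear_3_eq_affine_dependent by blast

lemma extreme_iff: "x extreme_point_of T \<longleftrightarrow> x \<in> {p, q, r}"
  by (rule extreme_point_of_convex_hull_affine_independent[OF affine_independent])

lemma vertices_distinct: "p \<noteq> q" "q \<noteq> r" "p \<noteq> r"
  using order by auto

lemma middle_not_on_chord: "chord p r (u q) \<noteq> h q"
proof
  assume "chord p r (u q) = h q"
  then have "q \<in> closed_segment p r"
    using pt_chord_closed_segment[of p r "u q"] order by simp
  then have "collinear {p, q, r}"
    by (simp add: between_imp_collinear between_mem_segment)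
  then show False using noncollinear by simp
qed

lemma segment_edge:
  assumes "x \<in> {p, q, r}" "y \<in> {p, q, r}" "x \<noteq> y" "z \<in> open_segment x y"
  shows "\<exists>e. e edge_of T \<and> z \<in> rel_interior e"
proof (intro exI conjI)
  have "convex hull {x, y} face_of T"
    unfolding face_of_convex_hull_affine_independent[OF affine_independent]
    using assms by (intro exI[of _ "{x, y}"]) auto
  then show "closed_segment x y edge_of T"
    using assms aff_dim_2[of x y] unfolding edge_of_def segment_convex_hull
    by (metis aff_dim_convex_hull)
  show "z \<in> rel_interior (closed_segment x y)"
    using assms by (simp add: rel_interior_closed_segment)
qed

end

section \<open>Triangles whose middle vertex lies above the long side\<close>

locale upper_triangle = sorted_triangle +
  assumes above: "chord p r (u q) < h q"
begin

lemma slopes: "slope p r < slope p q" "slope q r < slope p r"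
proof -
  have 1: "slope p r * (u q - u p) < slope p q * (u q - u p)"
    using above order by (simp add: chord_def slope_def)
  then show "slope p r < slope p q" using order by simp
  have "chord p r (u q) = h r - slope p r * (u r - u q)"
    using order by (simp add: chord_alt algebra_simps)
  then have "slope q r * (u r - u q) < slope p r * (u r - u q)"
    using above order by (simp add: slope_def)
  then show "slope q r < slope p r" using order by simp
qed

lemma chord_less:
  assumes "u p < s" "s < u r"
  shows "chord p r s < chord p q s" "chord p r s < chord q r s"
proof -
  show "chord p r s < chord p q s" using slopes assms by (simp add: chord_def)
  have "slope p r * (s - u r) < slope q r * (s - u r)"
    using slopes assms by (simp add: mult_strict_right_mono_neg)
  then show "chord p r s < chord q r s" using order by (simp add: chord_alt)
qed

text \<open>Both chords pass through \<open>q\<close> and the first is steeper, so the smaller of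
  the two changes exactly there.\<close>

lemma chord_pq_qr: "chord p q s \<le> chord q r s \<longleftrightarrow> s \<le> u q"
proof -
  have "chord p q s = h q + slope p q * (s - u q)" using order by (simp add: chord_alt)
  moreover have "chord q r s = h q + slope q r * (s - u q)" by (simp add: chord_def)
  ultimately have "chord p q s \<le> chord q r s \<longleftrightarrow> 0 \<le> (slope q r - slope p q) * (s - u q)"
    by (simp only:) (simp add: algebra_simps)
  also have "\<dots> \<longleftrightarrow> s \<le> u q" using slopes by (simp add: zero_le_mult_iff)
  finally show ?thesis .
qed

text \<open>One inclusion holds because the five half-planes are convex and contain the vertices.
  For the other, the point lies on a vertical slice between a point of the long side and a point of
  one of the short sides.\<close>

lemma mem_iff:
  "z \<in> T \<longleftrightarrow> u p \<le> u z \<and> u z \<le> u r \<and> chord p r (u z) \<le> h z \<and>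
     h z \<le> min (chord p q (u z)) (chord q r (u z))"
proof
  define H where "H = {z. u p \<le> u z} \<inter> {z. u z \<le> u r} \<inter> {z. chord p r (u z) \<le> h z} \<inter>
    {z. h z \<le> chord p q (u z)} \<inter> {z. h z \<le> chord q r (u z)}"
  have "convex H" unfolding H_def
  proof (intro convex_Int)
    show "convex {z. u p \<le> u z}" using convex_affine_ineq[of "u p" 1 0] by simp
    show "convex {z. u z \<le> u r}" using convex_affine_ineq[of "- u r" "-1" 0] by simp
    show "convex {z. chord p r (u z) \<le> h z}"
      using convex_affine_ineq[of "h p - slope p r * u p" "- slope p r" 1]
      by (simp add: chord_def algebra_simps)
    show "convex {z. h z \<le> chord p q (u z)}"
      using convex_affine_ineq[of "slope p q * u p - h p" "slope p q" "-1"]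
      by (simp add: chord_def algebra_simps)
    show "convex {z. h z \<le> chord q r (u z)}"
      using convex_affine_ineq[of "slope q r * u q - h q" "slope q r" "-1"]
      by (simp add: chord_def algebra_simps)
  qed
  moreover have "p \<in> H" "q \<in> H" "r \<in> H"
    using order above chord_pq_qr[of "u p"] chord_pq_qr[of "u r"] by (auto simp: H_def)
  ultimately have "T \<subseteq> H" by (intro hull_minimal) auto
  then show "z \<in> T \<Longrightarrow> u p \<le> u z \<and> u z \<le> u r \<and> chord p r (u z) \<le> h z \<and>
     h z \<le> min (chord p q (u z)) (chord q r (u z))"
    by (auto simp: H_def)
next
  assume z: "u p \<le> u z \<and> u z \<le> u r \<and> chord p r (u z) \<le> h z \<and>
     h z \<le> min (chord p q (u z)) (chord q r (u z))"
  have seg: "closed_segment x y \<subseteq> T" if "x \<in> {p,q,r}" "y \<in> {p,q,r}" for x y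
    using that by (simp add: closed_segment_subset_convex_hull hull_inc)
  have 1: "pt (u z) (chord p r (u z)) \<in> T"
    using pt_chord_closed_segment[of p r "u z"] seg[of p r] z order by auto
  show "z \<in> T"
  proof (cases "u z \<le> u q")
    case True
    then have 2: "pt (u z) (chord p q (u z)) \<in> T"
      using pt_chord_closed_segment[of p q "u z"] seg[of p q] z order by auto
    show ?thesis using convex_slice[OF _ 1 2, of "h z"] z by simp
  next
    case False
    then have 2: "pt (u z) (chord q r (u z)) \<in> T"
      using pt_chord_closed_segment[of q r "u z"] seg[of q r] z order by auto
    show ?thesis using convex_slice[OF _ 1 2, of "h z"] z by simp
  qed
qed

lemma hi_lo:
  assumes "u p \<le> s" "s \<le> u r"
  shows "hi T s = min (chord p q s) (chord q r s)" "lo T s = chord p r s"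
proof -
  have eq: "{y. pt s y \<in> T} = {chord p r s..min (chord p q s) (chord q r s)}"
    using assms mem_iff by auto
  have "chord p r s \<le> min (chord p q s) (chord q r s)"
  proof (cases "s = u p \<or> s = u r")
    case True
    then show ?thesis using order chord_pq_qr[of "u p"] chord_pq_qr[of "u r"] by auto
  next
    case False
    then show ?thesis using chord_less[of s] assms by simp
  qed
  then show "hi T s = min (chord p q s) (chord q r s)" "lo T s = chord p r s"
    unfolding hi_def lo_def eq by simp_all
qed


lemma lo_less_hi: "u p < s \<Longrightarrow> s < u r \<Longrightarrow> lo T s < hi T s"
  using hi_lo[of s] chord_less[of s] by simp

lemma continuous_on_hi: "continuous_on {u p..u r} (hi T)"
proof -
  have "continuous_on {u p..u r} (\<lambda>s. min (chord p q s) (chord q r s))"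
    unfolding chord_def by (intro continuous_intros)
  then show ?thesis by (rule continuous_on_eq) (simp add: hi_lo)
qed

lemma continuous_on_lo: "continuous_on {u p..u r} (lo T)"
proof -
  have "continuous_on {u p..u r} (chord p r)"
    unfolding chord_def by (intro continuous_intros)
  then show ?thesis by (rule continuous_on_eq) (simp add: hi_lo)
qed

lemma locally_affine_chord:
  assumes "open I" "s \<in> I" "\<And>t. t \<in> I \<Longrightarrow> f t = chord x y t"
  shows "locally_affine f s"
  unfolding locally_affine_def
proof
  have "\<forall>\<^sub>F t in nhds s. t \<in> I" using assms(1,2) by (rule eventually_nhds_in_open)
  then show "\<forall>\<^sub>F t in nhds s. f t = f s + slope x y * (t - s)"
  proof eventually_elim
    case (elim t)
    then show ?case using assms chord_shift[of x y t s] by simp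
  qed
qed

lemma hi_left: "u p \<le> s \<Longrightarrow> s \<le> u q \<Longrightarrow> hi T s = chord p q s"
  using hi_lo[of s] chord_pq_qr[of s] order by simp

lemma hi_right: "u q \<le> s \<Longrightarrow> s \<le> u r \<Longrightarrow> hi T s = chord q r s"
  using hi_lo[of s] chord_pq_qr[of s] order by (cases "s = u q") auto

text \<open>The two conclusions serve different ends: local affinity feeds \<open>touching\<close>,
  and the edge is the witness asked for by \<open>boundary_vertex\<close>.\<close>

lemma hi_nonvertex:
  assumes "u p < s" "s < u r" "\<not> pt s (hi T s) extreme_point_of T"
  shows "locally_affine (hi T) s" "\<exists>e. e edge_of T \<and> pt s (hi T s) \<in> rel_interior e"
proof -
  have "s \<noteq> u q"
  proof
    assume "s = u q"
    then have "pt s (hi T s) = q" using order by (simp add: hi_left)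
    then show False using assms(3) by (simp add: extreme_iff)
  qed
  then consider "s < u q" | "u q < s" by linarith
  then have "locally_affine (hi T) s \<and> (\<exists>e. e edge_of T \<and> pt s (hi T s) \<in> rel_interior e)"
  proof cases
    case 1
    have "locally_affine (hi T) s"
      using assms 1 by (intro locally_affine_chord[of "{u p<..<u q}"]) (auto simp: hi_left)
    moreover have "pt s (hi T s) \<in> open_segment p q"
      using assms 1 order by (simp add: hi_left pt_chord_open_segment)
    ultimately show ?thesis using segment_edge[of p q "pt s (hi T s)"] vertices_distinct by blast
  next
    case 2
    have "locally_affine (hi T) s"
      using assms 2 by (intro locally_affine_chord[of "{u q<..<u r}"]) (auto simp: hi_right)
    moreover have "pt s (hi T s) \<in> open_segment q r"
      using assms 2 order by (simp add: hi_right pt_chord_open_segment)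
    ultimately show ?thesis using segment_edge[of q r "pt s (hi T s)"] vertices_distinct by blast
  qed
  then show "locally_affine (hi T) s" "\<exists>e. e edge_of T \<and> pt s (hi T s) \<in> rel_interior e"
    by auto
qed

lemma lo_nonvertex:
  assumes "u p < s" "s < u r"
  shows "locally_affine (lo T) s" "\<exists>e. e edge_of T \<and> pt s (lo T s) \<in> rel_interior e"
proof -
  show "locally_affine (lo T) s"
    using assms by (intro locally_affine_chord[of "{u p<..<u r}"]) (auto simp: hi_lo)
  have "pt s (lo T s) \<in> open_segment p r"
    using assms order by (simp add: hi_lo pt_chord_open_segment)
  then show "\<exists>e. e edge_of T \<and> pt s (lo T s) \<in> rel_interior e"
    using segment_edge[of p r "pt s (lo T s)"] vertices_distinct by blast
qed

lemma dens_hi_has_integral: "(dens (hi T) has_integral dist p q + dist q r) {u p..u r}"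
  using order by (intro has_integral_combine[of "u p" "u q"] dens_has_integral)
    (auto simp: hi_left hi_right)

lemma dens_lo_has_integral: "(dens (lo T) has_integral dist p r) {u p..u r}"
  using order by (intro dens_has_integral) (auto simp: hi_lo)

end

section \<open>Reflection of heights and touching boundaries\<close>

context coords
begin

lemma hi_reflected: "coords.hi E (- d) T = (\<lambda>s. - lo T s)"
proof
  fix s
  have "{y. coords.pt E (- d) s y \<in> T} = uminus ` {y. pt s y \<in> T}"
  proof -
    have "coords.pt E (- d) s y = pt s (- y)" for y
      by (simp add: coords.pt_def[OF reflected] pt_def)
    then show ?thesis by (force simp: image_iff intro: exI[of _ "- _"])
  qed
  then show "coords.hi E (- d) T s = - lo T s"
    by (simp add: coords.hi_def[OF reflected] lo_def Inf_real_def)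
qed

lemma lo_reflected: "coords.lo E (- d) T = (\<lambda>s. - hi T s)"
proof -
  have "coords.hi E (- (- d)) T = (\<lambda>s. - coords.lo E (- d) T s)"
    by (rule coords.hi_reflected[OF reflected])
  then have "hi T s = - coords.lo E (- d) T s" for s by (simp add: fun_eq_iff)
  then show ?thesis by simp
qed

lemma pt_reflected: "coords.pt E (- d) s (- y) = pt s y"
  by (simp add: coords.pt_def[OF reflected] pt_def)

lemma locally_affine_uminus: "locally_affine (\<lambda>s. - f s) s \<Longrightarrow> locally_affine f s"
  unfolding locally_affine_def
proof (elim exE)
  fix m assume "\<forall>\<^sub>F t in nhds s. - f t = - f s + m * (t - s)"
  then have "\<forall>\<^sub>F t in nhds s. f t = f s + (- m) * (t - s)"
    by eventually_elim linarith
  then show "\<exists>m. \<forall>\<^sub>F t in nhds s. f t = f s + m * (t - s)" ..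
qed

lemma locally_affine_deriv:
  assumes "locally_affine f s"
  shows "(f has_real_derivative deriv f s) (at s)"
    "\<forall>\<^sub>F t in nhds s. f t = f s + deriv f s * (t - s)"
proof -
  obtain m where m: "\<forall>\<^sub>F t in nhds s. f t = f s + m * (t - s)"
    using assms unfolding locally_affine_def by blast
  have "((\<lambda>t. f s + m * (t - s)) has_real_derivative m) (at s)"
    by (auto intro!: derivative_eq_intros)
  then have D: "(f has_real_derivative m) (at s)"
    using DERIV_cong_ev[OF refl m refl] by blast
  then have "deriv f s = m" by (rule DERIV_imp_deriv)
  then show "(f has_real_derivative deriv f s) (at s)"
    "\<forall>\<^sub>F t in nhds s. f t = f s + deriv f s * (t - s)" using D m by auto
qed

text \<open>The difference \<open>g - f\<close> has a local minimum at \<open>s\<close>, so the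
  slopes agree there; two affine pieces with equal value and equal slope are the same. This converts
  contact at one point into contact along a segment.\<close>

lemma touching:
  assumes "locally_affine f s" "locally_affine g s" "\<forall>\<^sub>F t in nhds s. f t \<le> g t" "f s = g s"
  shows "deriv f s = deriv g s" "\<forall>\<^sub>F t in nhds s. f t = g t"
proof -
  have D: "((\<lambda>t. g t - f t) has_real_derivative deriv g s - deriv f s) (at s)"
    by (intro derivative_intros locally_affine_deriv assms)
  obtain e where "e > 0" "\<And>t. dist t s < e \<Longrightarrow> f t \<le> g t"
    using assms(3) unfolding eventually_nhds_metric by blast
  then have "deriv g s - deriv f s = 0"
    using DERIV_local_min[OF D, of e] assms(4) by (simp add: dist_real_def abs_minus_commute)
  then show eq: "deriv f s = deriv g s" by simp
  show "\<forall>\<^sub>F t in nhds s. f t = g t"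
    using locally_affine_deriv(2)[OF assms(1)] locally_affine_deriv(2)[OF assms(2)]
    by eventually_elim (simp add: eq assms(4))
qed

lemma chord_reflected: "coords.chord u (\<lambda>z. - h z) p q s = - chord p q s"
  by (simp add: coords.chord_def[OF reflected] coords.slope_def[OF reflected] chord_def slope_def
      divide_simps algebra_simps)

text \<open>The two minus signs cancel in \<open>E + deriv f s *\<^sub>R d\<close>. Local affinity
  guarantees that \<open>deriv\<close> really is a derivative, without which it need not change sign
  with \<open>f\<close>.\<close>

lemma dens_uminus:
  assumes "locally_affine f s"
  shows "coords.dens E (- d) (\<lambda>s. - f s) s = dens f s"
  using DERIV_imp_deriv[OF DERIV_minus[OF locally_affine_deriv(1)[OF assms]]]
  by (simp add: coords.dens_def[OF reflected] dens_def)

end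

section \<open>Arbitrary sorted triangles, reduced by reflection\<close>

context sorted_triangle
begin

lemma upper_cases:
  "upper_triangle u h E d p q r \<or> upper_triangle u (\<lambda>z. - h z) E (- d) p q r"
proof (cases "chord p r (u q) < h q")
  case True
  then show ?thesis by (intro disjI1 upper_triangle.intro upper_triangle_axioms.intro sorted_triangle_axioms)
next
  case False
  then have "coords.chord u (\<lambda>z. - h z) p r (u q) < - h q"
    using middle_not_on_chord by (simp add: chord_reflected)
  then show ?thesis
    by (intro disjI2 upper_triangle.intro upper_triangle_axioms.intro sorted_triangle.intro
        sorted_triangle_axioms.intro reflected order noncollinear) 
qed

lemma mem_iff:
  "z \<in> T \<longleftrightarrow> u p \<le> u z \<and> u z \<le> u r \<and> lo T (u z) \<le> h z \<and> h z \<le> hi T (u z)"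
  using upper_cases
proof
  assume "upper_triangle u h E d p q r"
  then interpret upper_triangle u h E d p q r .
  show ?thesis using mem_iff[of z] hi_lo[of "u z"] by auto
next
  assume "upper_triangle u (\<lambda>z. - h z) E (- d) p q r"
  then interpret R: upper_triangle u "\<lambda>z. - h z" E "- d" p q r .
  show ?thesis using R.mem_iff[of z] R.hi_lo[of "u z"]
    by (auto simp: hi_reflected lo_reflected)
qed

lemma lo_less_hi: "u p < s \<Longrightarrow> s < u r \<Longrightarrow> lo T s < hi T s"
  using upper_cases upper_triangle.lo_less_hi[of u h E d p q r s]
    upper_triangle.lo_less_hi[of u "\<lambda>z. - h z" E "- d" p q r s]
  by (auto simp: hi_reflected lo_reflected)

lemma continuous_on_hi: "continuous_on {u p..u r} (hi T)"
  using upper_cases upper_triangle.continuous_on_hi[of u h E d p q r]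
    upper_triangle.continuous_on_lo[of u "\<lambda>z. - h z" E "- d" p q r]
    continuous_on_minus[of "{u p..u r}" "\<lambda>s. - hi T s"]
  by (auto simp: hi_reflected lo_reflected)

lemma continuous_on_lo: "continuous_on {u p..u r} (lo T)"
  using upper_cases upper_triangle.continuous_on_lo[of u h E d p q r]
    upper_triangle.continuous_on_hi[of u "\<lambda>z. - h z" E "- d" p q r]
    continuous_on_minus[of "{u p..u r}" "\<lambda>s. - lo T s"]
  by (auto simp: hi_reflected lo_reflected)

lemma hi_nonvertex:
  assumes "u p < s" "s < u r" "\<not> pt s (hi T s) extreme_point_of T"
  shows "locally_affine (hi T) s" "\<exists>e. e edge_of T \<and> pt s (hi T s) \<in> rel_interior e"
  using upper_cases upper_triangle.hi_nonvertex[of u h E d p q r s]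
    upper_triangle.lo_nonvertex[of u "\<lambda>z. - h z" E "- d" p q r s] assms
  by (auto simp: hi_reflected lo_reflected pt_reflected dest: locally_affine_uminus)

lemma lo_nonvertex:
  assumes "u p < s" "s < u r" "\<not> pt s (lo T s) extreme_point_of T"
  shows "locally_affine (lo T) s" "\<exists>e. e edge_of T \<and> pt s (lo T s) \<in> rel_interior e"
  using upper_cases upper_triangle.lo_nonvertex[of u h E d p q r s]
    upper_triangle.hi_nonvertex[of u "\<lambda>z. - h z" E "- d" p q r s] assms
  by (auto simp: hi_reflected lo_reflected pt_reflected dest: locally_affine_uminus)

text \<open>In barycentric coordinates, \<open>u z - u p\<close> and \<open>u r - u z\<close> are
  sums of nonnegative terms with positive factors, so they vanish only at a vertex.\<close>

lemma vertex_if_end: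
  assumes "z \<in> T"
  shows "u z = u p \<Longrightarrow> z = p" "u z = u r \<Longrightarrow> z = r"
proof -
  obtain a b c where abc: "a \<ge> 0" "b \<ge> 0" "c \<ge> 0" "a + b + c = 1" "z = a *\<^sub>R p + b *\<^sub>R q + c *\<^sub>R r"
    using assms unfolding convex_hull_3 by blast
  then have uz: "u z = a * u p + b * u q + c * u r"
    by (simp only: real_scaleR_def linear_add[OF lin_u] linear_scale[OF lin_u])
  have "u z - u p = b * (u q - u p) + c * (u r - u p)"
  proof -
    have a: "a = 1 - b - c" using abc(4) by simp
    show ?thesis unfolding uz a by (simp add: algebra_simps)
  qed
  moreover have "b * (u q - u p) \<ge> 0" "c * (u r - u p) \<ge> 0" using abc order by auto
  ultimately have "u z = u p \<Longrightarrow> b * (u q - u p) = 0 \<and> c * (u r - u p) = 0" by linarith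
  then have "u z = u p \<Longrightarrow> b = 0 \<and> c = 0" using order by simp
  then show "z = p" if "u z = u p" using that abc(4,5) by simp
  have "u r - u z = b * (u r - u q) + a * (u r - u p)"
  proof -
    have c: "c = 1 - a - b" using abc(4) by simp
    show ?thesis unfolding uz c by (simp add: algebra_simps)
  qed
  moreover have "b * (u r - u q) \<ge> 0" "a * (u r - u p) \<ge> 0" using abc order by auto
  ultimately have "u z = u r \<Longrightarrow> b * (u r - u q) = 0 \<and> a * (u r - u p) = 0" by linarith
  then have "u z = u r \<Longrightarrow> b = 0 \<and> a = 0" using order by simp
  then show "z = r" if "u z = u r" using that abc(4,5) by simp
qed

lemma dens_has_integral_perimeter:
  "((\<lambda>s. dens (hi T) s + dens (lo T) s) has_integral dist p q + dist q r + dist p r) {u p..u r}"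
  using upper_cases
proof
  assume "upper_triangle u h E d p q r"
  then interpret upper_triangle u h E d p q r .
  show ?thesis by (intro has_integral_add dens_hi_has_integral dens_lo_has_integral)
next
  assume "upper_triangle u (\<lambda>z. - h z) E (- d) p q r"
  then interpret R: upper_triangle u "\<lambda>z. - h z" E "- d" p q r .
  have "((\<lambda>s. coords.dens E (- d) (\<lambda>s. - lo T s) s + coords.dens E (- d) (\<lambda>s. - hi T s) s)
      has_integral dist p q + dist q r + dist p r) {u p..u r}"
    using has_integral_add[OF R.dens_hi_has_integral R.dens_lo_has_integral]
    by (simp add: hi_reflected lo_reflected)
  then show ?thesis
  proof (rule has_integral_spike_finite[rotated 2])
    \<comment> \<open>The reflected densities agree with the original ones where the boundaries are
      locally affine; the three vertex parameters form a null set.\<close>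
    fix s assume s: "s \<in> {u p..u r} - {u p, u q, u r}"
    have "\<not> x extreme_point_of T" if "u x = s" for x
      using that s by (auto simp: extreme_iff)
    then have "locally_affine (hi T) s" "locally_affine (lo T) s"
      using hi_nonvertex(1)[of s] lo_nonvertex(1)[of s] s by auto
    then show "dens (hi T) s + dens (lo T) s =
        coords.dens E (- d) (\<lambda>s. - lo T s) s + coords.dens E (- d) (\<lambda>s. - hi T s) s"
      by (simp add: dens_uminus)
  qed simp
qed

end

section \<open>Tiles as sets, without named vertices\<close>

context coords
begin

text \<open>Strict on both sides: a line that meets \<open>T\<close> only in its first or last
  vertex is not \<open>over\<close> it. Tiles that begin or end on a line are thereby kept apart
  from those that continue across it.\<close>

definition over :: "complex set \<Rightarrow> real \<Rightarrow> bool" where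
  "over T s \<longleftrightarrow> (\<exists>z\<in>T. u z < s) \<and> (\<exists>z\<in>T. s < u z)"

definition tri :: "complex set \<Rightarrow> bool" where
  "tri T \<longleftrightarrow> (\<exists>p q r. sorted_triangle u h E d p q r \<and> T = convex hull {p, q, r})"

lemma filterlim_u: "filterlim u (nhds (u z)) (nhds z)"
  using tendsto_u[OF filterlim_ident, of z] .

lemma filterlim_h: "filterlim h (nhds (h z)) (nhds z)"
  using tendsto_h[OF filterlim_ident, of z] .

end

context sorted_triangle
begin

lemma over_iff: "over T s \<longleftrightarrow> u p < s \<and> s < u r"
proof
  assume "over T s"
  then show "u p < s \<and> s < u r" using mem_iff by (force simp: over_def)
next
  assume "u p < s \<and> s < u r"
  then show "over T s" unfolding over_def by (meson hull_inc insertCI)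
qed

lemma isCont_hi: "u p < s \<Longrightarrow> s < u r \<Longrightarrow> isCont (hi T) s"
  using continuous_on_interior[OF continuous_on_hi, of s] by simp

lemma isCont_lo: "u p < s \<Longrightarrow> s < u r \<Longrightarrow> isCont (lo T) s"
  using continuous_on_interior[OF continuous_on_lo, of s] by simp

text \<open>An interior point can be moved a little along \<open>E\<close>, \<open>-E\<close>,
  \<open>d\<close> and \<open>-d\<close>, which makes all four inequalities strict. Conversely,
  continuity of \<open>hi\<close> and \<open>lo\<close> makes the strict inequalities an open
  condition.\<close>

lemma interior_iff:
  "z \<in> interior T \<longleftrightarrow> (u p < u z \<and> u z < u r) \<and> lo T (u z) < h z \<and> h z < hi T (u z)"
proof
  assume z: "z \<in> interior T"
  have dir: "\<exists>\<epsilon>>0. z + \<epsilon> *\<^sub>R x \<in> T" for x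
  proof -
    have "((\<lambda>\<epsilon>. z + \<epsilon> *\<^sub>R x) \<longlongrightarrow> z + 0 *\<^sub>R x) (at_right 0)"
      by (intro tendsto_intros)
    then have "\<forall>\<^sub>F \<epsilon> in at_right 0. z + \<epsilon> *\<^sub>R x \<in> interior T"
      by (rule topological_tendstoD) (use z in auto)
    then have "\<forall>\<^sub>F \<epsilon> in at_right (0::real). 0 < \<epsilon> \<and> z + \<epsilon> *\<^sub>R x \<in> T"
      using eventually_at_right_less[of "0::real"] 
      by eventually_elim (use interior_subset in blast)
    then show ?thesis
      using eventually_happens'[of "at_right (0::real)"] trivial_limit_at_right_real by blast
  qed
  obtain e1 where "e1 > 0" "z + e1 *\<^sub>R E \<in> T" using dir by blast
  moreover obtain e2 where "e2 > 0" "z + e2 *\<^sub>R (- E) \<in> T" using dir by blast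
  moreover obtain e3 where "e3 > 0" "z + e3 *\<^sub>R d \<in> T" using dir by blast
  moreover obtain e4 where "e4 > 0" "z + e4 *\<^sub>R (- d) \<in> T" using dir by blast
  moreover have "u (z + e *\<^sub>R E) = u z + e" "u (z + e *\<^sub>R (- E)) = u z - e"
    "u (z + e *\<^sub>R d) = u z" "u (z + e *\<^sub>R (- d)) = u z"
    "h (z + e *\<^sub>R d) = h z + e" "h (z + e *\<^sub>R (- d)) = h z - e" for e
    by (simp_all add: linear_add[OF lin_u] linear_scale[OF lin_u] linear_diff[OF lin_u]
        linear_add[OF lin_h] linear_scale[OF lin_h] linear_diff[OF lin_h] basis)
  ultimately show "(u p < u z \<and> u z < u r) \<and> lo T (u z) < h z \<and> h z < hi T (u z)"
    using mem_iff[of "z + e1 *\<^sub>R E"] mem_iff[of "z + e2 *\<^sub>R (- E)"]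
      mem_iff[of "z + e3 *\<^sub>R d"] mem_iff[of "z + e4 *\<^sub>R (- d)"] by auto
next
  assume z: "(u p < u z \<and> u z < u r) \<and> lo T (u z) < h z \<and> h z < hi T (u z)"
  have hi: "((\<lambda>w. hi T (u w) - h w) \<longlongrightarrow> hi T (u z) - h z) (nhds z)"
    using z isCont_tendsto_compose[OF isCont_hi filterlim_u] filterlim_h
    by (intro tendsto_diff) auto
  have lo: "((\<lambda>w. h w - lo T (u w)) \<longlongrightarrow> h z - lo T (u z)) (nhds z)"
    using z isCont_tendsto_compose[OF isCont_lo filterlim_u] filterlim_h
    by (intro tendsto_diff) auto
  have "\<forall>\<^sub>F w in nhds z. 0 < hi T (u w) - h w" "\<forall>\<^sub>F w in nhds z. 0 < h w - lo T (u w)"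
    "\<forall>\<^sub>F w in nhds z. u p < u w" "\<forall>\<^sub>F w in nhds z. u w < u r"
    using z order_tendstoD(1)[OF hi, of 0] order_tendstoD(1)[OF lo, of 0]
    by (auto intro: order_tendstoD[OF filterlim_u])
  then have "\<forall>\<^sub>F w in nhds z. w \<in> T"
    by eventually_elim (simp add: mem_iff)
  then show "z \<in> interior T" by (auto simp: eventually_nhds interior_def)
qed

lemma hi_lo_ends:
  "hi T (u p) = h p" "lo T (u p) = h p" "hi T (u r) = h r" "lo T (u r) = h r"
proof -
  have p: "p \<in> T" "r \<in> T" by (simp_all add: hull_inc)
  then have le: "lo T (u p) \<le> h p" "h p \<le> hi T (u p)" "lo T (u r) \<le> h r" "h r \<le> hi T (u r)"
    using mem_iff by auto
  have "pt (u p) (hi T (u p)) \<in> T" "pt (u p) (lo T (u p)) \<in> T"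
    "pt (u r) (hi T (u r)) \<in> T" "pt (u r) (lo T (u r)) \<in> T"
    using le order mem_iff by auto
  then have "pt (u p) (hi T (u p)) = p" "pt (u p) (lo T (u p)) = p"
    "pt (u r) (hi T (u r)) = r" "pt (u r) (lo T (u r)) = r"
    using vertex_if_end by auto
  then show "hi T (u p) = h p" "lo T (u p) = h p" "hi T (u r) = h r" "lo T (u r) = h r"
    by (metis h_pt)+
qed

text \<open>A tile shrinks to its end vertex as the line approaches it. Hence the position of that
  vertex decides whether the tile appears above or below another one.\<close>

lemma near_end:
  assumes "z = p \<or> z = r" "e > 0"
  shows "\<forall>\<^sub>F t in nhds (u z). over T t \<longrightarrow> h z - e < lo T t \<and> hi T t < h z + e"
proof -
  have z: "u z \<in> {u p..u r}" using assms order by auto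
  have eq: "hi T (u z) = h z" "lo T (u z) = h z" using assms hi_lo_ends by auto
  obtain e1 where e1: "e1 > 0" "\<And>t. t \<in> {u p..u r} \<Longrightarrow> dist t (u z) < e1 \<Longrightarrow> dist (hi T t) (h z) < e"
    using continuous_on_hi[unfolded continuous_on_iff, rule_format, OF z \<open>e > 0\<close>] eq by auto
  obtain e2 where e2: "e2 > 0" "\<And>t. t \<in> {u p..u r} \<Longrightarrow> dist t (u z) < e2 \<Longrightarrow> dist (lo T t) (h z) < e"
    using continuous_on_lo[unfolded continuous_on_iff, rule_format, OF z \<open>e > 0\<close>] eq by auto
  show ?thesis unfolding eventually_nhds_metric
  proof (intro exI[of _ "min e1 e2"] conjI allI impI)
    fix t assume "dist t (u z) < min e1 e2" "over T t"
    then have "dist (hi T t) (h z) < e" "dist (lo T t) (h z) < e"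
      using e1 e2 over_iff by auto
    then show "h z - e < lo T t" "hi T t < h z + e" by (auto simp: dist_real_def)
  qed (use e1 e2 in auto)
qed

lemma over_near_end:
  "\<forall>\<^sub>F t in nhds (u p). over T t \<longleftrightarrow> u p < t"
  "\<forall>\<^sub>F t in nhds (u r). over T t \<longleftrightarrow> t < u r"
proof -
  have "\<forall>\<^sub>F t in nhds (u p). t \<in> {..<u r}" "\<forall>\<^sub>F t in nhds (u r). t \<in> {u p<..}"
    using order by (intro eventually_nhds_in_open; simp)+
  then show "\<forall>\<^sub>F t in nhds (u p). over T t \<longleftrightarrow> u p < t"
    "\<forall>\<^sub>F t in nhds (u r). over T t \<longleftrightarrow> t < u r"
    by (auto simp: over_iff elim!: eventually_mono)
qed

end

context coords
begin

lemma triE: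
  assumes "tri T"
  obtains p q r where "sorted_triangle u h E d p q r" "T = convex hull {p, q, r}"
    "\<And>s. over T s \<longleftrightarrow> u p < s \<and> s < u r"
  using assms sorted_triangle.over_iff[of u h E d] unfolding tri_def by blast

lemma tri_mem: "tri T \<Longrightarrow> over T s \<Longrightarrow> pt s y \<in> T \<longleftrightarrow> lo T s \<le> y \<and> y \<le> hi T s"
  by (erule triE) (simp add: sorted_triangle.mem_iff[of u h E d])

lemma tri_lo_less_hi: "tri T \<Longrightarrow> over T s \<Longrightarrow> lo T s < hi T s"
  by (erule triE) (simp add: sorted_triangle.lo_less_hi[of u h E d])

lemma tri_interior_iff:
  "tri T \<Longrightarrow> z \<in> interior T \<longleftrightarrow> over T (u z) \<and> lo T (u z) < h z \<and> h z < hi T (u z)"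
  by (erule triE) (simp add: sorted_triangle.interior_iff[of u h E d])

lemma tri_isCont: 
  assumes "tri T" "over T s"
  shows "isCont (hi T) s" "isCont (lo T) s"
  using assms(2) sorted_triangle.isCont_hi[of u h E d] sorted_triangle.isCont_lo[of u h E d]
  by (auto intro: triE[OF assms(1)])

lemma tri_hi_nonvertex:
  assumes "tri T" "over T s" "\<not> pt s (hi T s) extreme_point_of T"
  shows "locally_affine (hi T) s" "\<exists>e. e edge_of T \<and> pt s (hi T s) \<in> rel_interior e"
  by (rule triE[OF assms(1)], use assms(2,3) sorted_triangle.hi_nonvertex[of u h E d] in blast)+

lemma tri_lo_nonvertex:
  assumes "tri T" "over T s" "\<not> pt s (lo T s) extreme_point_of T"
  shows "locally_affine (lo T) s" "\<exists>e. e edge_of T \<and> pt s (lo T s) \<in> rel_interior e"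
  by (rule triE[OF assms(1)], use assms(2,3) sorted_triangle.lo_nonvertex[of u h E d] in blast)+

lemma tri_over_near: "tri T \<Longrightarrow> over T s \<Longrightarrow> \<forall>\<^sub>F t in nhds s. over T t"
proof (erule triE)
  fix p q r assume *: "over T s" "\<And>t. over T t \<longleftrightarrow> u p < t \<and> t < u r"
  have "\<forall>\<^sub>F t in nhds s. t \<in> {u p<..<u r}"
    using * by (intro eventually_nhds_in_open) auto
  then show ?thesis by eventually_elim (simp add: *)
qed

text \<open>If the line through a point of \<open>T\<close> is not \<open>over\<close> it, the point
  is the leftmost or the rightmost vertex, and the existence of a point further left tells
  which.\<close>

lemma tri_end:
  assumes "tri T" "z \<in> T" "\<not> over T (u z)"
  shows "z extreme_point_of T"
    "e > 0 \<Longrightarrow> \<forall>\<^sub>F t in nhds (u z). over T t \<longrightarrow> h z - e < lo T t \<and> hi T t < h z + e"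
    "if \<exists>w\<in>T. u w < u z then \<forall>\<^sub>F t in nhds (u z). over T t \<longleftrightarrow> t < u z
     else \<forall>\<^sub>F t in nhds (u z). over T t \<longleftrightarrow> u z < t"
proof -
  obtain p q r where pqr: "sorted_triangle u h E d p q r" and T: "T = convex hull {p, q, r}"
    using assms(1) unfolding tri_def by blast
  interpret sorted_triangle u h E d p q r by (rule pqr)
  have "u z = u p \<or> u z = u r" using assms mem_iff[of z] over_iff[of "u z"] T by auto
  then have z: "z = p \<or> z = r" using vertex_if_end assms(2) T by blast
  then show "z extreme_point_of T" using T by (auto simp: extreme_iff)
  show "\<forall>\<^sub>F t in nhds (u z). over T t \<longrightarrow> h z - e < lo T t \<and> hi T t < h z + e" if "e > 0"
    using near_end[OF z that] T by simp
  have "p \<in> T" using T by (simp add: hull_inc)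
  then have "z = r \<Longrightarrow> \<exists>w\<in>T. u w < u z" using order by (intro bexI[of _ p]) auto
  moreover have "z = p \<Longrightarrow> \<not> (\<exists>w\<in>T. u w < u z)" using mem_iff T by force
  ultimately show "if \<exists>w\<in>T. u w < u z then \<forall>\<^sub>F t in nhds (u z). over T t \<longleftrightarrow> t < u z
     else \<forall>\<^sub>F t in nhds (u z). over T t \<longleftrightarrow> u z < t"
    using over_near_end z T by auto
qed

lemma tri_outside:
  assumes "tri T" "s \<notin> u ` T"
  shows "\<forall>\<^sub>F t in nhds s. \<not> over T t"
proof -
  obtain p q r where pqr: "sorted_triangle u h E d p q r" and T: "T = convex hull {p, q, r}"
    using assms(1) unfolding tri_def by blast
  interpret sorted_triangle u h E d p q r by (rule pqr)
  have "s \<notin> {u p..u r}"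
  proof
    assume s: "s \<in> {u p..u r}"
    have "pt s (chord p r s) \<in> closed_segment p r" using s order by (intro pt_chord_closed_segment) auto
    then have "pt s (chord p r s) \<in> T"
      using T closed_segment_subset_convex_hull[of p "{p, q, r}" r] by (auto simp: hull_inc)
    then show False using assms(2) by force
  qed
  then have "\<forall>\<^sub>F t in nhds s. t \<in> - {u p..u r}"
    by (intro eventually_nhds_in_open) auto
  then show ?thesis by eventually_elim (auto simp: T over_iff)
qed

lemma tri_hi_le:
  assumes "tri T" "tri U" "T \<subseteq> U" "over T s"
  shows "over U s" "hi T s \<le> hi U s" "lo U s \<le> lo T s"
proof -
  show U: "over U s" using assms(3,4) by (auto simp: over_def)
  have "pt s (hi T s) \<in> T" "pt s (lo T s) \<in> T"
    using tri_mem[OF assms(1,4)] tri_lo_less_hi[OF assms(1,4)] by auto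
  then show "hi T s \<le> hi U s" "lo U s \<le> lo T s" using assms(3) tri_mem[OF assms(2) U] by blast+
qed

lemma triI:
  assumes "2 simplex T" "\<And>v w. v extreme_point_of T \<Longrightarrow> w extreme_point_of T \<Longrightarrow> u v = u w \<Longrightarrow> v = w"
  shows "tri T"
proof -
  obtain x y z where xyz: "T = convex hull {x, y, z}" "\<not> collinear {x, y, z}"
    and ext: "\<And>w. w extreme_point_of T \<longleftrightarrow> w \<in> {x, y, z}"
    using simplex_2E[OF assms(1)] by metis
  have perm: "tri T" if "u p < u q" "u q < u r" "{p, q, r} = {x, y, z}" for p q r
    unfolding tri_def
  proof (intro exI conjI)
    show "T = convex hull {p, q, r}" using xyz(1) that(3) by simp
    show "sorted_triangle u h E d p q r"
      using xyz(2) that coords_axioms by (simp add: sorted_triangle_def sorted_triangle_axioms_def)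
  qed
  have "{x, y, x} = {x, y}" by auto
  then have "x \<noteq> y" "y \<noteq> z" "x \<noteq> z" using xyz(2) collinear_2[of x y] collinear_2[of x z] by force+
  then have "u x \<noteq> u y" "u y \<noteq> u z" "u x \<noteq> u z"
    using assms(2)[of x y] assms(2)[of y z] assms(2)[of x z] ext by blast+
  then consider "u x < u y" "u y < u z" | "u x < u z" "u z < u y" | "u y < u x" "u x < u z"
    | "u y < u z" "u z < u x" | "u z < u x" "u x < u y" | "u z < u y" "u y < u x"
    by linarith
  then show ?thesis
  proof cases
    case 1
    then show ?thesis by (rule perm) auto
  next
    case 2
    then show ?thesis by (rule perm) auto
  next
    case 3
    then show ?thesis by (rule perm) auto
  next
    case 4
    then show ?thesis by (rule perm) auto
  next
    case 5
    then show ?thesis by (rule perm) auto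
  next
    case 6
    then show ?thesis by (rule perm) auto
  qed
qed

end

section \<open>Sweeping a tiling\<close>

text \<open>Allows a height to be moved off finitely many exceptional ones without jumping over any
  of them.\<close>

lemma gap_above:
  fixes F :: "real set"
  assumes "finite F" "y < m"
  obtains x where "y < x" "x \<le> m" "\<And>f. f \<in> F \<Longrightarrow> f \<le> y \<or> x < f"
proof -
  define M where "M = Min (insert m {f \<in> F. y < f})"
  have fin: "finite (insert m {f \<in> F. y < f})" using assms(1) by simp
  have "M \<in> insert m {f \<in> F. y < f}" unfolding M_def by (rule Min_in[OF fin]) simp
  then have "y < M" using assms(2) by auto
  have le: "M \<le> f" if "f = m \<or> f \<in> F \<and> y < f" for f
    unfolding M_def by (rule Min_le[OF fin]) (use that in auto)
  show thesis
  proof (rule that[of "(y + M) / 2"])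
    show "y < (y + M) / 2" "(y + M) / 2 \<le> m" using \<open>y < M\<close> le[of m] by auto
    show "f \<le> y \<or> (y + M) / 2 < f" if "f \<in> F" for f
      using le[of f] that \<open>y < M\<close> by fastforce
  qed
qed

lemma gap_below:
  fixes F :: "real set"
  assumes "finite F" "m < y"
  obtains x where "x < y" "m \<le> x" "\<And>f. f \<in> F \<Longrightarrow> y \<le> f \<or> f < x"
proof -
  obtain x where x: "- y < x" "x \<le> - m" "\<And>f. f \<in> uminus ` F \<Longrightarrow> f \<le> - y \<or> x < f"
    using gap_above[of "uminus ` F" "- y" "- m"] assms by auto
  show thesis
  proof (rule that[of "- x"])
    show "y \<le> f \<or> f < - x" if "f \<in> F" for f using x(3)[of "- f"] that by auto
  qed (use x in auto)
qed

text \<open>The values on \<open>K\<close> are arbitrary, but near each point of \<open>K\<close>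
  one \<open>P\<close> serves both sides, so connectedness of the interval carries the value
  across.\<close>

lemma bool_constant_on_interval:
  fixes f :: "real \<Rightarrow> bool"
  assumes "finite K"
    and local: "\<And>s. a < s \<Longrightarrow> s < b \<Longrightarrow> \<exists>P. \<forall>\<^sub>F t in nhds s. t \<notin> K \<longrightarrow> f t = P"
    and "s \<in> {a<..<b} - K" "t \<in> {a<..<b} - K"
  shows "f s = f t"
proof -
  have "connected {a<..<b}" by simp
  then have "f t = f s"
  proof (rule connected_induction[where P = "\<lambda>x. x \<notin> K" and Q = "\<lambda>x. f x = f s" and a = s])
    fix W x assume W: "openin (top_of_set {a<..<b}) W" "x \<in> W"
    have "open W" by (rule openin_open_trans[OF W(1)]) simp
    \<comment> \<open>A nonempty open set of reals is infinite and so cannot lie inside the finite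
      \<open>K\<close>.\<close>
    then have "infinite W" using W(2) finite_imp_not_open[of W] by auto
    then have "\<not> W \<subseteq> K" using finite_subset[OF _ assms(1)] by blast
    then show "\<exists>z. z \<in> W \<and> z \<notin> K" by blast
  next
    fix x assume x: "x \<in> {a<..<b}"
    have "a < x" "x < b" using x by simp_all
    from local[OF this] obtain P where "\<forall>\<^sub>F t in nhds x. t \<notin> K \<longrightarrow> f t = P" ..
    then obtain N where N: "open N" "x \<in> N" "\<And>t. t \<in> N \<Longrightarrow> t \<notin> K \<Longrightarrow> f t = P"
      unfolding eventually_nhds by blast
    show "\<exists>W. openin (top_of_set {a<..<b}) W \<and> x \<in> W \<and>
        (\<forall>y\<in>W. \<forall>z\<in>W. y \<notin> K \<and> z \<notin> K \<and> f y = f s \<longrightarrow> f z = f s)"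
    proof (intro exI conjI)
      show "openin (top_of_set {a<..<b}) ({a<..<b} \<inter> N)" by (rule openin_open_Int[OF N(1)])
      show "x \<in> {a<..<b} \<inter> N" using x N(2) by simp
      show "\<forall>y\<in>{a<..<b} \<inter> N. \<forall>z\<in>{a<..<b} \<inter> N. y \<notin> K \<and> z \<notin> K \<and> f y = f s \<longrightarrow> f z = f s"
        using N(3) by blast
    qed
  qed (use assms(3,4) in simp_all)
  then show ?thesis by simp
qed

text \<open>\<open>base_order\<close> and \<open>apex\<close> make \<open>BC\<close> the whole lower
  boundary and place \<open>A\<close> at the only bend of the upper one. By \<open>u_inj\<close> a
  line contains at most one vertex, so everything that changes on a line changes at a single
  point.\<close>

locale tiled_triangle = coords u h E d
  for u h :: "complex \<Rightarrow> real" and E d :: complex +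
  fixes A B C :: complex and \<T> :: "complex set set"
  assumes tiling: "tiling \<T> (convex hull {A, B, C})"
    and noncollinear: "\<not> collinear {A, B, C}"
    and base_order: "u B < u A" "u A < u C"
    and apex: "chord B C (u A) < h A"
    and u_inj: "\<And>v w. v \<in> {A, B, C} \<union> Collect (tiling_vertex \<T>) \<Longrightarrow>
      w \<in> {A, B, C} \<union> Collect (tiling_vertex \<T>) \<Longrightarrow> u v = u w \<Longrightarrow> v = w"
    and card_A: "card (tiles_at \<T> A) = 1"
    and boundary_odd: "\<And>v. boundary_vertex \<T> A B C v \<Longrightarrow> odd (card (tiles_at \<T> v))"
    and interior_even: "\<And>v. interior_vertex \<T> A B C v \<Longrightarrow> even (card (tiles_at \<T> v))"
begin

abbreviation "S \<equiv> convex hull {B, A, C}"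

lemma S_eq: "convex hull {A, B, C} = S"
  by (simp add: insert_commute)

sublocale S: upper_triangle u h E d B A C
  by (intro upper_triangle.intro sorted_triangle.intro coords_axioms sorted_triangle_axioms.intro
      upper_triangle_axioms.intro base_order apex) (use noncollinear in \<open>simp add: insert_commute\<close>)

lemma tri_S: "tri S"
  unfolding tri_def using S.sorted_triangle_axioms by blast

lemma finite_tiles: "finite \<T>" and simplex: "T \<in> \<T> \<Longrightarrow> 2 simplex T"
  and disjoint: "pairwise (\<lambda>T U. interior T \<inter> interior U = {}) \<T>"
  and Union_tiles: "\<Union>\<T> = S"
  using tiling S_eq by (auto simp: tiling_def)

lemma subset_S: "T \<in> \<T> \<Longrightarrow> T \<subseteq> S"
  using Union_tiles by blast

lemma tile_vertex: "T \<in> \<T> \<Longrightarrow> v extreme_point_of T \<Longrightarrow> v \<in> {A, B, C} \<union> Collect (tiling_vertex \<T>)"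
  by (auto simp: tiling_vertex_def)

lemma tri_tile:
  assumes "T \<in> \<T>"
  shows "tri T"
proof (rule triI[OF simplex[OF assms]])
  show "v = w" if "v extreme_point_of T" "w extreme_point_of T" "u v = u w" for v w
    using tile_vertex[OF assms] that by (intro u_inj)
qed

lemma extreme_in: "v extreme_point_of T \<Longrightarrow> v \<in> T"
  by (simp add: extreme_point_of_def)

section \<open>Tiles met by one line\<close>

definition Over :: "real \<Rightarrow> complex set set" where
  "Over s = {T \<in> \<T>. over T s}"

text \<open>Named after the side on which the tile lies: it is to the left of the line and ends
  there. The tiles in \<open>right_ends\<close> lie to the right and begin there.\<close>

definition left_ends :: "real \<Rightarrow> complex set set" where
  "left_ends s = {T \<in> \<T>. s \<in> u ` T \<and> \<not> over T s \<and> (\<exists>w\<in>T. u w < s)}"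

definition right_ends :: "real \<Rightarrow> complex set set" where
  "right_ends s = {T \<in> \<T>. s \<in> u ` T \<and> \<not> over T s \<and> \<not> (\<exists>w\<in>T. u w < s)}"

lemma finite_Over [simp]: "finite (Over s)" "finite (left_ends s)" "finite (right_ends s)"
  using finite_tiles by (simp_all add: Over_def left_ends_def right_ends_def)

lemma OverD:
  assumes "T \<in> Over s"
  shows "T \<in> \<T>" "tri T" "over T s"
  using assms tri_tile by (auto simp: Over_def)

text \<open>A tile is the closure of its interior, so touching the interior of \<open>T\<close> in
  one point already forces overlapping interiors.\<close>

lemma tile_unique: "T \<in> \<T> \<Longrightarrow> U \<in> \<T> \<Longrightarrow> z \<in> interior T \<Longrightarrow> z \<in> U \<Longrightarrow> U = T"
  using disjoint simplex_2_interior_meets[OF simplex, of U "interior T"]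
  by (auto simp: pairwise_def)

lemma not_interior_vertex:
  assumes "T \<in> \<T>" "v \<in> {A, B, C} \<union> Collect (tiling_vertex \<T>)" "v \<in> interior T"
  shows False
proof (cases "tiling_vertex \<T> v")
  case True
  then obtain U where "U \<in> \<T>" "v extreme_point_of U" by (auto simp: tiling_vertex_def)
  moreover then have "U = T" using tile_unique assms extreme_in by blast
  ultimately show False using extreme_point_not_in_interior assms(3) by blast
next
  case False
  then have "v extreme_point_of S" using assms by (auto simp: S.extreme_iff)
  moreover have "v \<in> interior S" using assms(3) interior_mono[OF subset_S[OF assms(1)]] by blast
  ultimately show False using extreme_point_not_in_interior by blast
qed

text \<open>Overlapping slices would have an inner point in common, here the midpoint of the
  overlap. This is the linear order of the tiles along a line.\<close>

lemma Over_separated: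
  assumes "T \<in> Over s" "U \<in> Over s" "T \<noteq> U"
  shows "hi T s \<le> lo U s \<or> hi U s \<le> lo T s"
proof (rule ccontr)
  assume *: "\<not> (hi T s \<le> lo U s \<or> hi U s \<le> lo T s)"
  define y where "y = (max (lo T s) (lo U s) + min (hi T s) (hi U s)) / 2"
  have "lo T s < hi T s" "lo U s < hi U s"
    using tri_lo_less_hi OverD assms by auto
  then have y: "lo T s < y" "y < hi T s" "lo U s < y" "y < hi U s"
    using * by (auto simp: y_def max_def min_def)
  then have "pt s y \<in> interior T" "pt s y \<in> U"
    using tri_interior_iff[of T "pt s y"] tri_mem[of U s y] OverD assms by auto
  then show False using tile_unique assms OverD by metis
qed

lemma Over_in_S:
  assumes "T \<in> Over s"
  shows "over S s" "hi T s \<le> hi S s" "lo S s \<le> lo T s" "lo T s < hi T s"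
  using tri_hi_le[OF _ tri_S subset_S] tri_lo_less_hi OverD[OF assms] by auto

lemma over_S: "over S s \<longleftrightarrow> u B < s \<and> s < u C"
  by (rule S.over_iff)

lemma finite_heights: "finite ((\<lambda>T. hi T s) ` \<T> \<union> (\<lambda>T. lo T s) ` \<T> \<union> h ` {v. tiling_vertex \<T> v})"
  using finite_tiles finite_tiling_vertices[OF finite_tiles simplex] by simp

text \<open>Avoiding the heights of vertices ensures that the tile found is really crossed, not just
  met in its first or last vertex.\<close>

lemma slice_tile:
  assumes "over S s" "lo S s \<le> y" "y \<le> hi S s" "y \<notin> h ` {v. tiling_vertex \<T> v}"
  obtains T where "T \<in> Over s" "lo T s \<le> y" "y \<le> hi T s"
proof -
  have "pt s y \<in> S" using assms tri_mem[OF tri_S] by simp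
  then obtain T where T: "T \<in> \<T>" "pt s y \<in> T" using Union_tiles by blast
  have "over T s"
  proof (rule ccontr)
    assume "\<not> over T s"
    then have "pt s y extreme_point_of T" using tri_end(1)[OF tri_tile T(2)] T(1) by simp
    then have "tiling_vertex \<T> (pt s y)" using T(1) by (auto simp: tiling_vertex_def)
    then show False using assms(4) imageI[of "pt s y" "{v. tiling_vertex \<T> v}" h] by simp
  qed
  then show thesis using that[of T] T tri_mem[OF tri_tile] by (auto simp: Over_def)
qed

text \<open>A tile is found at a height \<open>x\<close> slightly above \<open>y\<close>; no
  boundary height lies in between, so its lower boundary is already at or below \<open>y\<close>.
  This also works when \<open>y\<close> is the height of a vertex.\<close>

lemma tile_above:
  assumes "over S s" "lo S s \<le> y" "y < hi S s"
  obtains T where "T \<in> Over s" "lo T s \<le> y" "y < hi T s"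
proof -
  obtain x where x: "y < x" "x \<le> hi S s"
    "\<And>f. f \<in> (\<lambda>T. hi T s) ` \<T> \<union> (\<lambda>T. lo T s) ` \<T> \<union> h ` {v. tiling_vertex \<T> v} \<Longrightarrow> f \<le> y \<or> x < f"
    using gap_above[OF finite_heights assms(3)] by metis
  obtain T where T: "T \<in> Over s" "lo T s \<le> x" "x \<le> hi T s"
  proof (rule slice_tile[OF assms(1), of x])
    show "x \<notin> h ` {v. tiling_vertex \<T> v}" using x(1) x(3)[of x] by auto
  qed (use x assms in auto)
  have "lo T s \<le> y" using x(3)[of "lo T s"] T OverD by auto
  then show thesis using that T x(1) by auto
qed

lemma tile_below:
  assumes "over S s" "lo S s < y" "y \<le> hi S s"
  obtains T where "T \<in> Over s" "lo T s < y" "y \<le> hi T s"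
proof -
  obtain x where x: "x < y" "lo S s \<le> x"
    "\<And>f. f \<in> (\<lambda>T. hi T s) ` \<T> \<union> (\<lambda>T. lo T s) ` \<T> \<union> h ` {v. tiling_vertex \<T> v} \<Longrightarrow> y \<le> f \<or> f < x"
    using gap_below[OF finite_heights assms(2)] by metis
  obtain T where T: "T \<in> Over s" "lo T s \<le> x" "x \<le> hi T s"
  proof (rule slice_tile[OF assms(1), of x])
    show "x \<notin> h ` {v. tiling_vertex \<T> v}" using x(1) x(3)[of x] by auto
  qed (use x assms in auto)
  have "y \<le> hi T s" using x(3)[of "hi T s"] T OverD by auto
  then show thesis using that T x(1) by auto
qed

text \<open>The interior of \<open>V\<close> comes arbitrarily close to \<open>v\<close>, and its
  points lie in no other tile. Used by contradiction: if tiles crossing the line fill a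
  neighbourhood of \<open>v\<close>, there is no room for a tile that begins or ends at
  \<open>v\<close>.\<close>

lemma locally_covered:
  assumes "V \<in> \<T>" "v \<in> V" "\<W> \<subseteq> \<T>" "\<forall>\<^sub>F z in nhds v. z \<in> S \<longrightarrow> z \<in> \<Union>\<W>"
  shows "V \<in> \<W>"
proof -
  obtain N where N: "open N" "v \<in> N" "\<And>z. z \<in> N \<Longrightarrow> z \<in> S \<Longrightarrow> z \<in> \<Union>\<W>"
    using assms(4) unfolding eventually_nhds by blast
  then have "N \<inter> interior V \<noteq> {}"
    using simplex_2_interior_meets[OF simplex[OF assms(1)] N(1)] assms(2) by blast
  then obtain z where z: "z \<in> N" "z \<in> interior V" by blast
  then have "z \<in> S" using assms(1) subset_S interior_subset by blast
  then obtain W where "W \<in> \<W>" "z \<in> W" using N z by blast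
  then show ?thesis using tile_unique[of V W z] assms z by blast
qed

section \<open>Tiles around a vertex on the line\<close>

lemma eventually_nhds_u: "eventually P (nhds (u v)) \<Longrightarrow> \<forall>\<^sub>F z in nhds v. P (u z)"
  by (rule eventually_compose_filterlim[OF _ filterlim_u])

lemma tendsto_hi: "T \<in> Over s \<Longrightarrow> (f \<longlongrightarrow> s) F \<Longrightarrow> ((\<lambda>x. hi T (f x)) \<longlongrightarrow> hi T s) F"
  by (rule isCont_tendsto_compose[OF tri_isCont(1)[OF OverD(2,3)]])

lemma tendsto_lo: "T \<in> Over s \<Longrightarrow> (f \<longlongrightarrow> s) F \<Longrightarrow> ((\<lambda>x. lo T (f x)) \<longlongrightarrow> lo T s) F"
  by (rule isCont_tendsto_compose[OF tri_isCont(2)[OF OverD(2,3)]])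

lemma eventually_below_hi:
  assumes "T \<in> Over (u v)" "h v < hi T (u v)"
  shows "\<forall>\<^sub>F z in nhds v. h z < hi T (u z)"
proof -
  have "((\<lambda>z. hi T (u z) - h z) \<longlongrightarrow> hi T (u v) - h v) (nhds v)"
    by (intro tendsto_diff tendsto_hi[OF assms(1)] filterlim_u filterlim_h)
  from order_tendstoD(1)[OF this, of 0] show ?thesis using assms by simp
qed

lemma eventually_above_lo:
  assumes "T \<in> Over (u v)" "lo T (u v) < h v"
  shows "\<forall>\<^sub>F z in nhds v. lo T (u z) < h z"
proof -
  have "((\<lambda>z. h z - lo T (u z)) \<longlongrightarrow> h v - lo T (u v)) (nhds v)"
    by (intro tendsto_diff tendsto_lo[OF assms(1)] filterlim_u filterlim_h)
  from order_tendstoD(1)[OF this, of 0] show ?thesis using assms by simp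
qed

lemma eventually_Over:
  assumes "T \<in> Over s"
  shows "\<forall>\<^sub>F t in nhds s. T \<in> Over t"
  using tri_over_near[OF OverD(2,3)[OF assms]] OverD(1)[OF assms] by (simp add: Over_def)

text \<open>Away from \<open>A\<close> the upper side is straight at \<open>v\<close>. If
  \<open>v\<close> were not a vertex of the topmost tile \<open>U\<close>, their boundaries would
  coincide near \<open>v\<close> by \<open>touching\<close>, and \<open>U\<close> would fill the
  triangle there, leaving no room for \<open>V\<close>.\<close>

lemma at_top_side:
  assumes "V \<in> \<T>" "v \<in> V" "\<not> over V (u v)" "over S (u v)" "h v = hi S (u v)" "v \<noteq> A"
  shows "\<exists>U. {T \<in> Over (u v). v \<in> T} = {U} \<and> v extreme_point_of U"
proof -
  let ?s = "u v"
  have "lo S ?s < h v" using assms tri_lo_less_hi[OF tri_S] by simp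
  then obtain U where U: "U \<in> Over ?s" "lo U ?s < h v" "h v \<le> hi U ?s"
    using tile_below[OF assms(4)] assms(5) by (metis order_refl)
  then have hiU: "hi U ?s = h v" using Over_in_S[OF U(1)] assms(5) by simp
  have "T = U" if "T \<in> Over ?s" "v \<in> T" for T
  proof (rule ccontr)
    assume "T \<noteq> U"
    have "lo T ?s \<le> h v \<and> h v \<le> hi T ?s" using tri_mem[of T ?s "h v"] OverD[OF that(1)] that(2) by simp
    then show False
      using Over_separated[OF that(1) U(1) \<open>T \<noteq> U\<close>] Over_in_S[OF that(1)] U(2) hiU assms(5) by auto
  qed
  moreover have "v \<in> U" using tri_mem[of U ?s "h v"] OverD[OF U(1)] U hiU by simp
  moreover have "v extreme_point_of U"
  proof (rule ccontr)
    assume "\<not> v extreme_point_of U"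
    then have aff_U: "locally_affine (hi U) ?s"
      using tri_hi_nonvertex(1)[of U ?s] OverD[OF U(1)] hiU by simp
    have "v \<noteq> B" "v \<noteq> C" using assms(4) over_S by auto
    then have "\<not> v extreme_point_of S" using \<open>v \<noteq> A\<close> by (simp add: S.extreme_iff)
    then have aff_S: "locally_affine (hi S) ?s"
      using tri_hi_nonvertex(1)[OF tri_S assms(4)] assms(5) by (metis pt_uh)
    have le: "\<forall>\<^sub>F t in nhds ?s. hi U t \<le> hi S t"
      using eventually_Over[OF U(1)] by eventually_elim (rule Over_in_S)
    have eq: "\<forall>\<^sub>F t in nhds ?s. hi U t = hi S t"
      using touching(2)[OF aff_U aff_S le] hiU assms(5) by simp
    have "\<forall>\<^sub>F z in nhds v. z \<in> S \<longrightarrow> z \<in> \<Union>{U}"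
      using eventually_nhds_u[OF eq] eventually_nhds_u[OF eventually_Over[OF U(1)]]
        eventually_above_lo[OF U(1,2)]
    proof eventually_elim
      case (elim z)
      then show ?case
        using tri_mem[of U "u z" "h z"] OverD[of U "u z"] tri_mem[OF tri_S, of "u z" "h z"]
          Over_in_S(1)[of U "u z"] by simp
    qed
    then have "V \<in> {U}" by (rule locally_covered[OF assms(1,2), rotated]) (use OverD(1)[OF U(1)] in auto)
    then show False using assms(3) OverD(3)[OF U(1)] by auto
  qed
  ultimately show ?thesis using U(1) by blast
qed

text \<open>As for the upper side; here no point is excepted, since \<open>BC\<close> has no
  bend.\<close>

lemma at_bottom_side:
  assumes "V \<in> \<T>" "v \<in> V" "\<not> over V (u v)" "over S (u v)" "h v = lo S (u v)"
  shows "\<exists>U. {T \<in> Over (u v). v \<in> T} = {U} \<and> v extreme_point_of U"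
proof -
  let ?s = "u v"
  have "h v < hi S ?s" using assms tri_lo_less_hi[OF tri_S] by simp
  then obtain U where U: "U \<in> Over ?s" "lo U ?s \<le> h v" "h v < hi U ?s"
    using tile_above[OF assms(4)] assms(5) by (metis order_refl)
  then have loU: "lo U ?s = h v" using Over_in_S[OF U(1)] assms(5) by simp
  have "T = U" if "T \<in> Over ?s" "v \<in> T" for T
  proof (rule ccontr)
    assume "T \<noteq> U"
    have "lo T ?s \<le> h v \<and> h v \<le> hi T ?s" using tri_mem[of T ?s "h v"] OverD[OF that(1)] that(2) by simp
    then show False
      using Over_separated[OF that(1) U(1) \<open>T \<noteq> U\<close>] Over_in_S[OF that(1)] U(3) loU assms(5) by auto
  qed
  moreover have "v \<in> U" using tri_mem[of U ?s "h v"] OverD[OF U(1)] U loU by simp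
  moreover have "v extreme_point_of U"
  proof (rule ccontr)
    assume "\<not> v extreme_point_of U"
    then have aff_U: "locally_affine (lo U) ?s"
      using tri_lo_nonvertex(1)[of U ?s] OverD[OF U(1)] loU by simp
    have aff_S: "locally_affine (lo S) ?s"
      using S.lo_nonvertex(1)[of ?s] assms(4) over_S by blast
    have le: "\<forall>\<^sub>F t in nhds ?s. lo S t \<le> lo U t"
      using eventually_Over[OF U(1)] by eventually_elim (rule Over_in_S)
    have eq: "\<forall>\<^sub>F t in nhds ?s. lo S t = lo U t"
      using touching(2)[OF aff_S aff_U le] loU assms(5) by simp
    have "\<forall>\<^sub>F z in nhds v. z \<in> S \<longrightarrow> z \<in> \<Union>{U}"
      using eventually_nhds_u[OF eq] eventually_nhds_u[OF eventually_Over[OF U(1)]]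
        eventually_below_hi[OF U(1,3)]
    proof eventually_elim
      case (elim z)
      then show ?case
        using tri_mem[of U "u z" "h z"] OverD[of U "u z"] tri_mem[OF tri_S, of "u z" "h z"]
          Over_in_S(1)[of U "u z"] by simp
    qed
    then have "V \<in> {U}" by (rule locally_covered[OF assms(1,2), rotated]) (use OverD(1)[OF U(1)] in auto)
    then show False using assms(3) OverD(3)[OF U(1)] by auto
  qed
  ultimately show ?thesis using U(1) by blast
qed

text \<open>\<open>U1\<close> and \<open>U2\<close> are the crossing tiles directly above and below
  \<open>v\<close>. If \<open>v\<close> were a vertex of neither, their boundaries would touch along
  a segment and the two tiles would cover a neighbourhood of \<open>v\<close>, contradicting the end
  of \<open>V\<close>.\<close>

lemma at_inside:
  assumes "V \<in> \<T>" "v \<in> V" "\<not> over V (u v)" "lo S (u v) < h v" "h v < hi S (u v)" "over S (u v)"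
  obtains U1 U2 where "U1 \<noteq> U2" "{T \<in> Over (u v). v \<in> T} = {U1, U2}"
    "v extreme_point_of U1 \<or> v extreme_point_of U2"
    "\<And>U. U \<in> {U1, U2} \<Longrightarrow> v extreme_point_of U \<or> (\<exists>e. e edge_of U \<and> v \<in> rel_interior e)"
proof -
  let ?s = "u v"
  have vert: "v \<in> {A, B, C} \<union> Collect (tiling_vertex \<T>)"
    by (rule tile_vertex[OF assms(1) tri_end(1)[OF tri_tile[OF assms(1)] assms(2,3)]])
  obtain U1 where U1: "U1 \<in> Over ?s" "lo U1 ?s \<le> h v" "h v < hi U1 ?s"
    using tile_above[OF assms(6), of "h v"] assms(4,5) by auto
  obtain U2 where U2: "U2 \<in> Over ?s" "lo U2 ?s < h v" "h v \<le> hi U2 ?s"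
    using tile_below[OF assms(6), of "h v"] assms(4,5) by auto
  \<comment> \<open>Being a vertex, \<open>v\<close> is not interior to any tile, so on the line it
    is an end of the slice of every crossing tile that contains it.\<close>
  have end_if_in: "h v = lo T ?s \<or> h v = hi T ?s" if "T \<in> Over ?s" "v \<in> T" for T
    using not_interior_vertex[OF _ vert, of T] tri_interior_iff[of T v] tri_mem[of T ?s "h v"] OverD[OF that(1)] that(2)
    by auto
  have in1: "v \<in> U1" using tri_mem[of U1 ?s "h v"] OverD[OF U1(1)] U1 by simp
  have in2: "v \<in> U2" using tri_mem[of U2 ?s "h v"] OverD[OF U2(1)] U2 by simp
  have eq1: "lo U1 ?s = h v" using end_if_in[OF U1(1) in1] U1 by simp
  have eq2: "hi U2 ?s = h v" using end_if_in[OF U2(1) in2] U2 by simp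
  have ne: "U1 \<noteq> U2" using eq1 U2(2) by auto
  have mem: "T \<in> {U1, U2}" if T: "T \<in> Over ?s" "v \<in> T" for T
  proof (rule ccontr)
    assume *: "T \<notin> {U1, U2}"
    then have "hi T ?s \<le> lo U1 ?s \<or> hi U1 ?s \<le> lo T ?s" "hi T ?s \<le> lo U2 ?s \<or> hi U2 ?s \<le> lo T ?s"
      using Over_separated[OF T(1) U1(1)] Over_separated[OF T(1) U2(1)] by auto
    then show False using end_if_in[OF T] Over_in_S(4)[OF T(1)] U1 U2 eq1 eq2 by auto
  qed
  have edge1: "v extreme_point_of U1 \<or> (\<exists>e. e edge_of U1 \<and> v \<in> rel_interior e)"
    using tri_lo_nonvertex(2)[of U1 ?s] OverD[OF U1(1)] eq1 by auto
  have edge2: "v extreme_point_of U2 \<or> (\<exists>e. e edge_of U2 \<and> v \<in> rel_interior e)"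
    using tri_hi_nonvertex(2)[of U2 ?s] OverD[OF U2(1)] eq2 by auto
  have vertex_either: "v extreme_point_of U1 \<or> v extreme_point_of U2"
  proof (rule ccontr)
    assume *: "\<not> (v extreme_point_of U1 \<or> v extreme_point_of U2)"
    have aff1: "locally_affine (lo U1) ?s"
      using tri_lo_nonvertex(1)[of U1 ?s] OverD[OF U1(1)] eq1 * by simp
    have aff2: "locally_affine (hi U2) ?s"
      using tri_hi_nonvertex(1)[of U2 ?s] OverD[OF U2(1)] eq2 * by simp
    have "\<forall>\<^sub>F t in nhds ?s. lo U2 t < hi U1 t"
    proof -
      have "((\<lambda>t. hi U1 t - lo U2 t) \<longlongrightarrow> hi U1 ?s - lo U2 ?s) (nhds ?s)"
        by (intro tendsto_diff tendsto_hi[OF U1(1)] tendsto_lo[OF U2(1)] filterlim_ident)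
      from order_tendstoD(1)[OF this, of 0] show ?thesis using U1 U2 by simp
    qed
    then have le: "\<forall>\<^sub>F t in nhds ?s. hi U2 t \<le> lo U1 t"
      using eventually_Over[OF U1(1)] eventually_Over[OF U2(1)]
    proof eventually_elim
      case (elim t)
      then show ?case using Over_separated[of U1 t U2] ne by auto
    qed
    have eq: "\<forall>\<^sub>F t in nhds ?s. hi U2 t = lo U1 t"
      using touching(2)[OF aff2 aff1 le] eq1 eq2 by simp
    have "\<forall>\<^sub>F z in nhds v. z \<in> S \<longrightarrow> z \<in> \<Union>{U1, U2}"
      using eventually_nhds_u[OF eq] eventually_nhds_u[OF eventually_Over[OF U1(1)]]
        eventually_nhds_u[OF eventually_Over[OF U2(1)]]
        eventually_below_hi[OF U1(1,3)] eventually_above_lo[OF U2(1,2)]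
    proof eventually_elim
      case (elim z)
      then show ?case
        using tri_mem[of U1 "u z" "h z"] OverD[of U1 "u z"] tri_mem[of U2 "u z" "h z"] OverD[of U2 "u z"]
        by auto
    qed
    then have "V \<in> {U1, U2}" by (rule locally_covered[OF assms(1,2), rotated]) (use OverD(1)[OF U1(1)] OverD(1)[OF U2(1)] in auto)
    then show False using assms(3) OverD(3)[OF U1(1)] OverD(3)[OF U2(1)] by auto
  qed
  have "{T \<in> Over ?s. v \<in> T} = {U1, U2}"
    using mem U1(1) U2(1) in1 in2 by blast
  have "v extreme_point_of U \<or> (\<exists>e. e edge_of U \<and> v \<in> rel_interior e)" if "U \<in> {U1, U2}" for U
    using that edge1 edge2 by auto
  from that[OF ne \<open>{T \<in> Over ?s. v \<in> T} = {U1, U2}\<close> vertex_either this] show thesis .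
qed

section \<open>Tiles beginning and ending on a critical line\<close>

definition verts :: "complex set" where
  "verts = {A, B, C} \<union> Collect (tiling_vertex \<T>)"

definition crit :: "real set" where
  "crit = u ` verts"

lemma finite_crit: "finite crit"
  using finite_tiling_vertices[OF finite_tiles simplex] by (simp add: crit_def verts_def)

lemma end_vertex:
  assumes "T \<in> \<T>" "z \<in> T" "\<not> over T (u z)"
  shows "z extreme_point_of T" "z \<in> verts"
proof -
  show *: "z extreme_point_of T" by (rule tri_end(1)[OF tri_tile[OF assms(1)] assms(2,3)])
  show "z \<in> verts" unfolding verts_def by (rule tile_vertex[OF assms(1) *])
qed

lemma verts_inj: "v \<in> verts \<Longrightarrow> w \<in> verts \<Longrightarrow> u v = u w \<Longrightarrow> v = w"
  unfolding verts_def by (rule u_inj)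

text \<open>The tiles at \<open>v\<close> are those that begin or end there together with
  \<open>M\<close>. Where an odd number of tiles meet, \<open>M\<close> has one element; where an
  even number meet, it has two. At \<open>A\<close> the single tile is itself a crossing one, so
  nothing begins or ends there.\<close>

lemma ends_even:
  assumes "over S s"
  shows "even (card (left_ends s) + card (right_ends s))"
proof (cases "left_ends s \<union> right_ends s = {}")
  case True
  then show ?thesis by simp
next
  case False
  then obtain V v where V: "V \<in> \<T>" "v \<in> V" "u v = s" "\<not> over V (u v)"
    by (auto simp: left_ends_def right_ends_def)
  note v = end_vertex[OF V(1,2,4)]
  have ends_v: "v extreme_point_of T" if "T \<in> \<T>" "s \<in> u ` T" "\<not> over T s" for T
  proof -
    obtain z where z: "z \<in> T" "u z = s" using \<open>s \<in> u ` T\<close> by auto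
    have "z extreme_point_of T \<and> z \<in> verts" using end_vertex[OF that(1) z(1)] that z by simp
    moreover have "z = v" using verts_inj[of z v] calculation v(2) V(3) z(2) by blast
    ultimately show ?thesis by simp
  qed
  define M where "M = {T \<in> tiles_at \<T> v. over T s}"
  have at: "tiles_at \<T> v = (left_ends s \<union> right_ends s) \<union> M"
    using ends_v V(3) extreme_in by (auto simp: left_ends_def right_ends_def M_def tiles_at_def)
  have "finite M" using finite_tiles by (simp add: M_def tiles_at_def)
  then have "card (tiles_at \<T> v) = card (left_ends s \<union> right_ends s) + card M"
    unfolding at by (intro card_Un_disjoint) (auto simp: left_ends_def right_ends_def M_def finite_tiles)
  moreover have "card (left_ends s \<union> right_ends s) = card (left_ends s) + card (right_ends s)"
    by (intro card_Un_disjoint) (auto simp: left_ends_def right_ends_def finite_tiles)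
  ultimately have card_at: "card (tiles_at \<T> v) = card (left_ends s) + card (right_ends s) + card M"
    by simp
  have M_eq: "M = {T \<in> {T \<in> Over s. v \<in> T}. v extreme_point_of T}"
    using extreme_in by (auto simp: M_def tiles_at_def Over_def)
  have tv: "tiling_vertex \<T> v" using V(1) v(1) by (auto simp: tiling_vertex_def)
  have nBC: "v \<noteq> B" "v \<noteq> C" using assms over_S V(3) by auto
  have vS: "v \<in> S" using V subset_S by blast
  then have h_v: "lo S s \<le> h v" "h v \<le> hi S s" using tri_mem[OF tri_S assms, of "h v"] V(3) by auto
  have boundary: "v \<noteq> A \<Longrightarrow> v \<in> frontier S \<or> (\<exists>T\<in>\<T>. \<exists>e. e edge_of T \<and> v \<in> rel_interior e) \<Longrightarrow>
      odd (card (tiles_at \<T> v))"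
    using boundary_odd[of v] tv nBC unfolding boundary_vertex_def S_eq by blast
  have frontier: "v \<in> frontier S" if "h v = lo S s \<or> h v = hi S s"
    using that vS tri_interior_iff[OF tri_S, of v] closure_subset V(3) unfolding frontier_def by auto
  consider "v = A" | "v \<noteq> A" "h v = hi S s" | "v \<noteq> A" "h v = lo S s" | "v \<noteq> A" "lo S s < h v" "h v < hi S s"
    using h_v by linarith
  then show ?thesis
  proof cases
    case 1
    \<comment> \<open>The tile crossed just below \<open>A\<close> has a vertex at \<open>A\<close>
      and thus uses up the one allowed by \<open>card_A\<close>.\<close>
    have "hi S s = h A" using S.hi_left[of "u A"] base_order 1 V(3) by simp
    then obtain T where T: "T \<in> Over s" "lo T s < h A" "h A \<le> hi T s"
      using tile_below[OF assms, of "h A"] tri_lo_less_hi[OF tri_S assms] by auto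
    moreover have "pt s (h A) = A"
    proof -
      have "s = u A" using 1 V(3) by simp
      then show ?thesis by (simp only: pt_uh)
    qed
    ultimately have "A \<in> T" using tri_mem[OF OverD(2,3)[OF T(1)], of "h A"] by simp
    moreover have "A extreme_point_of S" by (simp add: S.extreme_iff)
    ultimately have "A extreme_point_of T"
      using subset_S[OF OverD(1)[OF T(1)]] by (auto simp: extreme_point_of_def)
    then have "T \<in> M" using T(1) OverD[OF T(1)] 1 by (simp add: M_def tiles_at_def)
    then have "card M > 0" using \<open>finite M\<close> card_gt_0_iff by blast
    then have "card (left_ends s) + card (right_ends s) = 0"
      using card_at card_A unfolding 1 by linarith
    then show ?thesis by simp
  next
    case 2
    obtain U where "{T \<in> Over s. v \<in> T} = {U}" "v extreme_point_of U"
      using at_top_side[OF V(1,2,4)] assms 2 V(3) by auto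
    then have "M = {U}" unfolding M_eq by auto
    then show ?thesis using boundary frontier 2 card_at by auto
  next
    case 3
    obtain U where "{T \<in> Over s. v \<in> T} = {U}" "v extreme_point_of U"
      using at_bottom_side[OF V(1,2,4)] assms 3 V(3) by auto
    then have "M = {U}" unfolding M_eq by auto
    then show ?thesis using boundary frontier 3 card_at by auto
  next
    case 4
    obtain U1 U2 where U: "U1 \<noteq> U2" "{T \<in> Over s. v \<in> T} = {U1, U2}"
      "v extreme_point_of U1 \<or> v extreme_point_of U2"
      and edge: "\<And>U. U \<in> {U1, U2} \<Longrightarrow> v extreme_point_of U \<or> (\<exists>e. e edge_of U \<and> v \<in> rel_interior e)"
      by (rule at_inside[OF V(1,2,4), unfolded V(3), OF 4(2,3) assms]) (rule that)
    have tiles: "U1 \<in> \<T>" "U2 \<in> \<T>" using U(2) OverD(1) by blast+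
    show ?thesis
    proof (cases "v extreme_point_of U1 \<and> v extreme_point_of U2")
      case True
      then have "M = {U1, U2}" unfolding M_eq U(2) by auto
      then have "card M = 2" using U(1) by simp
      \<comment> \<open>Crossing tiles through \<open>v\<close> are \<open>U1\<close> and
        \<open>U2\<close>, the others begin or end at \<open>v\<close>; so all have a vertex there,
        as the angle sum requires.\<close>
      have "v extreme_point_of T" if "T \<in> \<T>" "v \<in> T" for T
      proof (cases "over T s")
        case over: True
        then have "T \<in> {U1, U2}" using U(2) that by (auto simp: Over_def)
        then show ?thesis using True by auto
      next
        case False
        then show ?thesis using end_vertex(1)[OF that] V(3) by simp
      qed
      moreover have "v \<in> interior (\<Union>\<T>)"
        using tri_interior_iff[OF tri_S, of v] assms 4 V(3) by (simp add: Union_tiles)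
      ultimately have "(\<Sum>T\<in>tiles_at \<T> v. tile_angle T v) = 2 * pi"
        by (intro angle_sum_around_point finite_tiles simplex disjoint)
      then have "even (card (tiles_at \<T> v))"
        using interior_even[of v] tv nBC 4 by (simp add: interior_vertex_def)
      then show ?thesis using card_at \<open>card M = 2\<close> by simp
    next
      case False
      then have "card M = 1"
      proof -
        have "M = {U1} \<or> M = {U2}" unfolding M_eq U(2) using False U(3) by auto
        then show ?thesis by auto
      qed
      \<comment> \<open>The tile without a vertex at \<open>v\<close> has \<open>v\<close> inside
        one of its sides, which makes \<open>v\<close> a boundary vertex although it is interior to
        the large triangle.\<close>
      moreover have "\<exists>T\<in>\<T>. \<exists>e. e edge_of T \<and> v \<in> rel_interior e"
        using False edge[of U1] edge[of U2] tiles by blast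
      ultimately show ?thesis using boundary 4 card_at by auto
    qed
  qed
qed

section \<open>Parity of the position on a line\<close>

definition Above :: "real \<Rightarrow> complex set \<Rightarrow> complex set set" where
  "Above s T = {U \<in> Over s. hi T s \<le> lo U s}"

text \<open>For \<open>t\<close> near \<open>s\<close>, the tiles crossed at \<open>t\<close> but
  not at \<open>s\<close>: to the left those that end at \<open>s\<close>, to the right those that
  begin there.\<close>

definition side_ends :: "real \<Rightarrow> real \<Rightarrow> complex set set" where
  "side_ends s t = (if t < s then left_ends s else if s < t then right_ends s else {})"

lemma finite_Above [simp]: "finite (Above s T)"
  by (simp add: Above_def)

lemma finite_side_ends [simp]: "finite (side_ends s t)"
  by (simp add: side_ends_def)

lemma side_ends_sub: "side_ends s t \<subseteq> \<T>" "side_ends s t \<inter> Over s = {}"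
  by (auto simp: side_ends_def left_ends_def right_ends_def Over_def)

lemma ends_noncritical: "s \<notin> crit \<Longrightarrow> left_ends s = {}" "s \<notin> crit \<Longrightarrow> right_ends s = {}"
  using end_vertex(2) by (auto simp: left_ends_def right_ends_def crit_def)

lemma end_over_near:
  assumes "U \<in> \<T>" "z \<in> U" "\<not> over U (u z)"
  shows "\<forall>\<^sub>F t in nhds (u z). over U t \<longleftrightarrow> U \<in> side_ends (u z) t"
proof (cases "\<exists>w\<in>U. u w < u z")
  case True
  then have "\<forall>\<^sub>F t in nhds (u z). over U t \<longleftrightarrow> t < u z"
    using tri_end(3)[OF tri_tile[OF assms(1)] assms(2,3)] by simp
  then show ?thesis
    by eventually_elim (use True assms in \<open>auto simp: side_ends_def left_ends_def right_ends_def\<close>)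
next
  case False
  then have "\<forall>\<^sub>F t in nhds (u z). over U t \<longleftrightarrow> u z < t"
    using tri_end(3)[OF tri_tile[OF assms(1)] assms(2,3)] by simp
  then show ?thesis
    by eventually_elim (use False assms in \<open>auto simp: side_ends_def left_ends_def right_ends_def\<close>)
qed

lemma Over_near: "\<forall>\<^sub>F t in nhds s. Over t = Over s \<union> side_ends s t"
proof -
  have "\<forall>\<^sub>F t in nhds s. U \<in> Over t \<longleftrightarrow> U \<in> Over s \<union> side_ends s t" if U: "U \<in> \<T>" for U
  proof -
    consider "U \<in> Over s" | "s \<notin> u ` U" | z where "z \<in> U" "u z = s" "\<not> over U (u z)"
      using U by (auto simp: Over_def)
    then show ?thesis
    proof cases
      case 1
      then show ?thesis using eventually_Over[OF 1] by simp
    next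
      case 2
      then have "U \<notin> Over s" unfolding Over_def
        using tri_mem[OF tri_tile[OF U], of s "hi U s"] tri_lo_less_hi[OF tri_tile[OF U], of s]
        by (auto simp: image_iff) (metis u_pt less_eq_real_def order_refl)
      moreover have "U \<notin> side_ends s t" for t
        using 2 by (auto simp: side_ends_def left_ends_def right_ends_def)
      moreover have "\<forall>\<^sub>F t in nhds s. \<not> over U t" by (rule tri_outside[OF tri_tile[OF U] 2])
      ultimately show ?thesis by (auto simp: Over_def elim!: eventually_mono)
    next
      case 3
      then show ?thesis using end_over_near[OF U 3(1,3)] U by (simp add: Over_def)
    qed
  qed
  then have "\<forall>\<^sub>F t in nhds s. \<forall>U\<in>\<T>. U \<in> Over t \<longleftrightarrow> U \<in> Over s \<union> side_ends s t"
    by (intro eventually_ball_finite finite_tiles) blast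
  then show ?thesis
    by eventually_elim (use side_ends_sub in \<open>auto simp: Over_def\<close>)
qed

text \<open>All tiles beginning or ending on the line do so at one vertex, so near the line they are
  either all above \<open>T\<close> or none is. The flag \<open>\<kappa>\<close> is chosen before
  \<open>t\<close> and hence is the same on both sides.\<close>

lemma Above_near:
  assumes T: "T \<in> Over s"
  shows "\<exists>\<kappa>. \<forall>\<^sub>F t in nhds s. Above t T = Above s T \<union> (if \<kappa> then side_ends s t else {})"
proof -
  \<comment> \<open>Asks whether the vertex on the line lies above \<open>T\<close>; the inequality
    is weak because a vertex on the upper boundary of \<open>T\<close> also has its tiles above
    \<open>T\<close>.\<close>
  define \<kappa> where "\<kappa> \<longleftrightarrow> (\<exists>v\<in>verts. u v = s \<and> hi T s \<le> h v)"
  have "\<forall>\<^sub>F t in nhds s. U \<in> Above t T \<longleftrightarrow> U \<in> Above s T \<union> (if \<kappa> then side_ends s t else {})"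
    if U: "U \<in> \<T>" for U
  proof -
    consider "U = T" | "U \<in> Over s" "U \<noteq> T" | "U \<notin> Over s" "s \<notin> u ` U"
      | z where "z \<in> U" "u z = s" "\<not> over U (u z)"
      using U by (auto simp: Over_def)
    then show ?thesis
    proof cases
      case 1
      have "\<forall>\<^sub>F t in nhds s. T \<notin> Above t T"
        using eventually_Over[OF T]
        by eventually_elim (simp add: Above_def Over_in_S(4) not_le)
      moreover have "T \<notin> Above s T \<union> (if \<kappa> then side_ends s t else {})" for t
        using Over_in_S(4)[OF T] side_ends_sub(2) T by (auto simp: Above_def)
      ultimately show ?thesis using 1 by (simp only: simp_thms)
    next
      case 2
      have not_side: "U \<notin> (if \<kappa> then side_ends s t else {})" for t using 2 side_ends_sub(2) by auto
      show ?thesis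
      proof (cases "hi T s \<le> lo U s")
        case True
        then have in_Above: "U \<in> Above s T" using 2 by (simp add: Above_def)
        have "((\<lambda>t. hi U t - lo T t) \<longlongrightarrow> hi U s - lo T s) (nhds s)"
          by (intro tendsto_diff tendsto_hi[OF 2(1)] tendsto_lo[OF T] filterlim_ident)
        then have "\<forall>\<^sub>F t in nhds s. 0 < hi U t - lo T t"
          by (rule order_tendstoD) (use True Over_in_S(4)[OF T] Over_in_S(4)[OF 2(1)] in linarith)
        then show ?thesis using eventually_Over[OF T] eventually_Over[OF 2(1)]
        proof eventually_elim
          case (elim t)
          then have "hi T t \<le> lo U t" using Over_separated[of U t T] 2(2) by linarith
          then show ?case using elim in_Above by (simp add: Above_def)
        qed
      next
        case False
        then have "U \<notin> Above s T" by (simp add: Above_def)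
        have "((\<lambda>t. hi T t - lo U t) \<longlongrightarrow> hi T s - lo U s) (nhds s)"
          by (intro tendsto_diff tendsto_hi[OF T] tendsto_lo[OF 2(1)] filterlim_ident)
        then have "\<forall>\<^sub>F t in nhds s. 0 < hi T t - lo U t"
          by (rule order_tendstoD) (use False in linarith)
        then show ?thesis
          by eventually_elim (use \<open>U \<notin> Above s T\<close> not_side in \<open>auto simp: Above_def\<close>)
      qed
    next
      case 3
      have "U \<notin> side_ends s t" for t
        using 3 by (auto simp: side_ends_def left_ends_def right_ends_def)
      moreover have "\<not> over U s" using 3(1) U by (simp add: Over_def)
      moreover have "\<forall>\<^sub>F t in nhds s. \<not> over U t" by (rule tri_outside[OF tri_tile[OF U] 3(2)])
      ultimately show ?thesis by (auto simp: Over_def Above_def elim!: eventually_mono)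
    next
      case 4
      then have z: "z \<in> verts" using end_vertex(2)[OF U] by simp
      have \<kappa>: "\<kappa> \<longleftrightarrow> hi T s \<le> h z"
        using z 4(2) verts_inj[OF z] unfolding \<kappa>_def by metis
      have "U \<notin> Above s T" "U \<noteq> T" using 4 T by (auto simp: Above_def Over_def)
      have not_int: "hi T s \<le> h z \<or> h z \<le> lo T s"
        using not_interior_vertex[OF OverD(1)[OF T], of z] z tri_interior_iff[OF OverD(2)[OF T], of z]
          OverD(3)[OF T] 4(2) unfolding verts_def by auto
      note near = end_over_near[OF U 4(1,3), unfolded 4(2)]
      show ?thesis
      proof (cases "hi T s \<le> h z")
        case True
        \<comment> \<open>Half the distance from the vertex to the lower boundary of
          \<open>T\<close>: near the line \<open>U\<close> then stays above \<open>lo T\<close>, and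
          by separation it must lie above all of \<open>T\<close>.\<close>
        define e where "e = (h z - lo T s) / 2"
        have "e > 0" using True Over_in_S(4)[OF T] by (simp add: e_def)
        have 1: "\<forall>\<^sub>F t in nhds s. over U t \<longrightarrow> h z - e < lo U t \<and> hi U t < h z + e"
          using tri_end(2)[OF tri_tile[OF U] 4(1,3) \<open>e > 0\<close>] 4(2) by simp
        have 2: "\<forall>\<^sub>F t in nhds s. lo T t < h z - e"
          by (rule order_tendstoD(2)[OF tendsto_lo[OF T filterlim_ident]])
            (use \<open>e > 0\<close> in \<open>simp add: e_def field_simps\<close>)
        show ?thesis using near 1 2 eventually_Over[OF T]
        proof eventually_elim
          case (elim t)
          have "hi T t \<le> lo U t" if "over U t"
            using Over_separated[of T t U] Over_in_S(4)[of U t] elim that U \<open>U \<noteq> T\<close>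
            by (auto simp: Over_def)
          then show ?case using elim True \<kappa> \<open>U \<notin> Above s T\<close> U by (auto simp: Above_def Over_def)
        qed
      next
        case False
        define e where "e = hi T s - h z"
        have "e > 0" using False by (simp add: e_def)
        have 1: "\<forall>\<^sub>F t in nhds s. over U t \<longrightarrow> h z - e / 2 < lo U t \<and> hi U t < h z + e / 2"
          using tri_end(2)[OF tri_tile[OF U] 4(1,3), of "e / 2"] \<open>e > 0\<close> 4(2) by simp
        have 2: "\<forall>\<^sub>F t in nhds s. h z + e / 2 < hi T t"
          by (rule order_tendstoD(1)[OF tendsto_hi[OF T filterlim_ident]])
            (use \<open>e > 0\<close> in \<open>simp add: e_def field_simps\<close>)
        show ?thesis using 1 2
        proof eventually_elim
          case (elim t)
          have "\<not> hi T t \<le> lo U t" if "U \<in> Over t"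
            using elim OverD(3)[OF that] Over_in_S(4)[OF that] by linarith
          then show ?case using False \<kappa> \<open>U \<notin> Above s T\<close> by (auto simp: Above_def)
        qed
      qed
    qed
  qed
  then have "\<forall>\<^sub>F t in nhds s. \<forall>U\<in>\<T>. U \<in> Above t T \<longleftrightarrow> U \<in> Above s T \<union> (if \<kappa> then side_ends s t else {})"
    by (intro eventually_ball_finite finite_tiles) blast
  then have "\<forall>\<^sub>F t in nhds s. Above t T = Above s T \<union> (if \<kappa> then side_ends s t else {})"
  proof eventually_elim
    case (elim t)
    have "Above t T \<subseteq> \<T>" "Above s T \<union> (if \<kappa> then side_ends s t else {}) \<subseteq> \<T>"
      using side_ends_sub(1)[of s t] by (auto simp: Above_def Over_def)
    then show ?case using elim by blast
  qed
  then show ?thesis by blast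
qed

text \<open>By \<open>ends_even\<close> both sides of the line see the same parity. Excluding
  critical \<open>t\<close> rules out \<open>t = s\<close> on a vertex line, where
  \<open>side_ends\<close> is empty whatever begins or ends there.\<close>

lemma card_side_ends_even:
  assumes "over S s" "t \<notin> crit"
  shows "even (card (side_ends s t)) \<longleftrightarrow> even (card (left_ends s))"
proof (cases "s = t")
  case True
  then show ?thesis using ends_noncritical[of s] assms(2) by (simp add: side_ends_def)
next
  case False
  then show ?thesis using ends_even[OF assms(1)] by (auto simp: side_ends_def)
qed

lemma rank_parity_near:
  assumes T: "T \<in> Over s"
  shows "\<exists>P. \<forall>\<^sub>F t in nhds s. t \<notin> crit \<longrightarrow> even (card (Above t T)) = P"
proof -
  obtain \<kappa> where near: "\<forall>\<^sub>F t in nhds s. Above t T = Above s T \<union> (if \<kappa> then side_ends s t else {})"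
    using Above_near[OF T] by blast
  have "\<forall>\<^sub>F t in nhds s. t \<notin> crit \<longrightarrow> even (card (Above t T)) =
      even (card (Above s T) + (if \<kappa> then card (left_ends s) else 0))"
    using near
  proof eventually_elim
    case (elim t)
    have "Above s T \<inter> side_ends s t = {}" using side_ends_sub(2) by (auto simp: Above_def)
    then have "card (Above t T) = card (Above s T) + (if \<kappa> then card (side_ends s t) else 0)"
      unfolding elim by (simp add: card_Un_disjoint)
    then show ?case using card_side_ends_even[OF Over_in_S(1)[OF T], of t] by auto
  qed
  then show ?thesis by blast
qed

lemma count_parity_near:
  assumes "over S s"
  shows "\<exists>P. \<forall>\<^sub>F t in nhds s. t \<notin> crit \<longrightarrow> even (card (Over t)) = P"
proof -
  have "\<forall>\<^sub>F t in nhds s. t \<notin> crit \<longrightarrow> even (card (Over t)) = even (card (Over s) + card (left_ends s))"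
    using Over_near[of s]
  proof eventually_elim
    case (elim t)
    have "card (Over t) = card (Over s) + card (side_ends s t)"
      unfolding elim using side_ends_sub(2)[of s t] by (intro card_Un_disjoint) auto
    then show ?case using card_side_ends_even[OF assms, of t] by auto
  qed
  then show ?thesis by blast
qed

end

section \<open>Coloring and perimeters\<close>

context tiled_triangle
begin

lemma S_vertices_critical: "u A \<in> crit" "u B \<in> crit" "u C \<in> crit"
  by (auto simp: crit_def verts_def)

lemma pick_noncritical:
  assumes "\<forall>\<^sub>F t in nhds s. P t"
  obtains t where "s < t" "t \<notin> crit" "P t"
proof -
  obtain e where e: "e > 0" "\<And>t. dist t s < e \<Longrightarrow> P t"
    using assms unfolding eventually_nhds_metric by blast
  have "infinite {s<..<s + e}" using e(1) by (simp add: infinite_Ioo)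
  then have "\<not> {s<..<s + e} \<subseteq> crit" using finite_subset[OF _ finite_crit] by blast
  then obtain t where "t \<in> {s<..<s + e}" "t \<notin> crit" by blast
  then have t: "s < t" "t < s + e" "t \<notin> crit" by simp_all
  then have "P t" using e(2)[of t] by (simp add: dist_real_def)
  then show thesis using that t by blast
qed

lemma noncritical_affine:
  assumes "T \<in> Over s" "s \<notin> crit"
  shows "locally_affine (hi T) s" "locally_affine (lo T) s"
proof -
  have "\<not> pt s y extreme_point_of T" for y
  proof
    assume "pt s y extreme_point_of T"
    then have "pt s y \<in> verts" unfolding verts_def by (rule tile_vertex[OF OverD(1)[OF assms(1)]])
    then have "u (pt s y) \<in> crit" unfolding crit_def by (rule imageI)
    then show False using assms(2) by simp
  qed
  then show "locally_affine (hi T) s" "locally_affine (lo T) s"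
    using tri_hi_nonvertex(1)[OF OverD(2,3)[OF assms(1)]] tri_lo_nonvertex(1)[OF OverD(2,3)[OF assms(1)]]
    by blast+
qed

lemma noncritical_affine_S:
  assumes "over S s" "s \<notin> crit"
  shows "locally_affine (hi S) s" "locally_affine (lo S) s"
proof -
  have "\<not> pt s y extreme_point_of S" for y
  proof
    assume "pt s y extreme_point_of S"
    then have "pt s y \<in> verts" by (auto simp: S.extreme_iff verts_def)
    then have "u (pt s y) \<in> crit" unfolding crit_def by (rule imageI)
    then show False using assms(2) by simp
  qed
  then show "locally_affine (hi S) s" "locally_affine (lo S) s"
    using tri_hi_nonvertex(1)[OF tri_S assms(1)] tri_lo_nonvertex(1)[OF tri_S assms(1)]
    by blast+
qed

section \<open>Neighbours along a noncritical line\<close>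

lemma Over_hi_inj: "T \<in> Over s \<Longrightarrow> U \<in> Over s \<Longrightarrow> hi T s = hi U s \<Longrightarrow> T = U"
  using Over_separated[of T s U] Over_in_S(4)[of T s] Over_in_S(4)[of U s] by fastforce

lemma Over_lo_inj: "T \<in> Over s \<Longrightarrow> U \<in> Over s \<Longrightarrow> lo T s = lo U s \<Longrightarrow> T = U"
  using Over_separated[of T s U] Over_in_S(4)[of T s] Over_in_S(4)[of U s] by fastforce

lemma top_tile:
  assumes "over S s"
  obtains T where "T \<in> Over s" "hi T s = hi S s"
proof -
  obtain T where "T \<in> Over s" "lo T s < hi S s" "hi S s \<le> hi T s"
    using tile_below[OF assms, of "hi S s"] tri_lo_less_hi[OF tri_S assms] by auto
  then show thesis using that[of T] Over_in_S(2)[of T s] by simp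
qed

lemma bottom_tile:
  assumes "over S s"
  obtains T where "T \<in> Over s" "lo T s = lo S s"
proof -
  obtain T where "T \<in> Over s" "lo T s \<le> lo S s" "lo S s < hi T s"
    using tile_above[OF assms, of "lo S s"] tri_lo_less_hi[OF tri_S assms] by auto
  then show thesis using that[of T] Over_in_S(3)[of T s] by simp
qed

lemma next_above:
  assumes "T \<in> Over s" "hi T s \<noteq> hi S s"
  shows "\<exists>U\<in>Over s. lo U s = hi T s"
proof -
  note T = Over_in_S[OF assms(1)]
  obtain U where U: "U \<in> Over s" "lo U s \<le> hi T s" "hi T s < hi U s"
    by (rule tile_above[OF T(1), of "hi T s"]) (use T assms(2) in auto)
  then have "T \<noteq> U" by auto
  then have "lo U s = hi T s"
    using Over_separated[OF assms(1) U(1)] U T Over_in_S(4)[OF U(1)] by auto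
  then show ?thesis using U(1) by blast
qed

lemma next_below:
  assumes "T \<in> Over s" "lo T s \<noteq> lo S s"
  shows "\<exists>U\<in>Over s. hi U s = lo T s"
proof -
  note T = Over_in_S[OF assms(1)]
  obtain U where U: "U \<in> Over s" "lo U s < lo T s" "lo T s \<le> hi U s"
    by (rule tile_below[OF T(1), of "lo T s"]) (use T assms(2) in auto)
  then have "T \<noteq> U" by auto
  then have "hi U s = lo T s"
    using Over_separated[OF assms(1) U(1)] U T Over_in_S(4)[OF U(1)] by auto
  then show ?thesis using U(1) by blast
qed

lemma card_Above_next:
  assumes "T \<in> Over s" "U \<in> Over s" "lo U s = hi T s"
  shows "card (Above s T) = Suc (card (Above s U))"
proof -
  have "Above s T = insert U (Above s U)"
  proof (intro equalityI subsetI)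
    fix W assume W: "W \<in> Above s T"
    then have "W \<in> Over s" "hi T s \<le> lo W s" by (auto simp: Above_def)
    then show "W \<in> insert U (Above s U)"
      using Over_separated[of W s U] Over_in_S(4)[of W s] assms by (fastforce simp: Above_def)
  next
    fix W assume "W \<in> insert U (Above s U)"
    then show "W \<in> Above s T" using assms Over_in_S(4)[OF assms(2)] by (auto simp: Above_def)
  qed
  moreover have "U \<notin> Above s U" using Over_in_S(4)[OF assms(2)] by (auto simp: Above_def)
  ultimately show ?thesis by simp
qed

lemma Above_top: "hi T s = hi S s \<Longrightarrow> Above s T = {}"
  using Over_in_S(2,4) by (fastforce simp: Above_def)

lemma Above_bottom:
  assumes "T \<in> Over s" "lo T s = lo S s"
  shows "Above s T = Over s - {T}"
proof (intro equalityI subsetI)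
  fix W assume "W \<in> Above s T"
  then show "W \<in> Over s - {T}" using Over_in_S(4)[OF assms(1)] by (auto simp: Above_def)
next
  fix W assume W: "W \<in> Over s - {T}"
  then have "W \<in> Over s" "W \<noteq> T" by auto
  then show "W \<in> Above s T"
    using Over_separated[of W s T] Over_in_S(3,4)[of W s] assms by (auto simp: Above_def)
qed

text \<open>Continuity keeps \<open>U\<close> above \<open>T\<close> on nearby lines, so their
  boundaries meet at \<open>s\<close> without crossing, and \<open>touching\<close> applies.\<close>

lemma adjacent_touch:
  assumes "s \<notin> crit" "T \<in> Over s" "U \<in> Over s" "lo U s = hi T s"
  shows "deriv (hi T) s = deriv (lo U) s" "\<forall>\<^sub>F t in nhds s. hi T t = lo U t"
proof -
  have "T \<noteq> U" using Over_in_S(4)[OF assms(2)] assms(4) by auto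
  have "((\<lambda>t. hi U t - lo T t) \<longlongrightarrow> hi U s - lo T s) (nhds s)"
    by (intro tendsto_diff tendsto_hi[OF assms(3)] tendsto_lo[OF assms(2)] filterlim_ident)
  then have "\<forall>\<^sub>F t in nhds s. 0 < hi U t - lo T t"
    by (rule order_tendstoD) (use assms(4) Over_in_S(4)[OF assms(2)] Over_in_S(4)[OF assms(3)] in linarith)
  then have le: "\<forall>\<^sub>F t in nhds s. hi T t \<le> lo U t"
    using eventually_Over[OF assms(2)] eventually_Over[OF assms(3)]
  proof eventually_elim
    case (elim t)
    then show ?case using Over_separated[of T t U] \<open>T \<noteq> U\<close> by linarith
  qed
  show "deriv (hi T) s = deriv (lo U) s" "\<forall>\<^sub>F t in nhds s. hi T t = lo U t"
    by (rule touching[OF noncritical_affine(1)[OF assms(2,1)] noncritical_affine(2)[OF assms(3,1)] le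
          assms(4)[symmetric]])+
qed

lemma in_frontier:
  assumes "T \<in> Over s" "y = hi T s \<or> y = lo T s"
  shows "pt s y \<in> frontier T"
proof -
  have "lo T s \<le> y \<and> y \<le> hi T s" using Over_in_S(4)[OF assms(1)] assms(2) by auto
  then have "pt s y \<in> T" by (simp only: tri_mem[OF OverD(2,3)[OF assms(1)]])
  moreover have "pt s y \<notin> interior T" using tri_interior_iff[OF OverD(2)[OF assms(1)], of "pt s y"] assms(2) by auto
  ultimately show ?thesis using closure_subset[of T] by (auto simp: frontier_def)
qed

lemma adjacent_share_segment:
  assumes "s \<notin> crit" "T \<in> Over s" "U \<in> Over s" "lo U s = hi T s"
  shows "share_segment T U"
proof -
  have "\<forall>\<^sub>F t in nhds s. T \<in> Over t \<and> U \<in> Over t \<and> hi T t = lo U t \<and>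
      hi T t = hi T s + deriv (hi T) s * (t - s)"
    by (intro eventually_conj eventually_Over assms(2,3) adjacent_touch(2)[OF assms]
        locally_affine_deriv(2) noncritical_affine(1)[OF assms(2,1)])
  then obtain e where e: "e > 0" and near: "\<And>t. dist t s < e \<Longrightarrow> T \<in> Over t \<and> U \<in> Over t \<and>
      hi T t = lo U t \<and> hi T t = hi T s + deriv (hi T) s * (t - s)"
    unfolding eventually_nhds_metric by blast
  \<comment> \<open>Any second line within the radius \<open>e\<close> will do; the common boundary
    between the two lines is the shared segment.\<close>
  define t where "t = s + e / 2"
  have t: "dist t s < e" "s < t" using e by (auto simp: t_def dist_real_def)
  define p q where "p = pt s (hi T s)" and "q = pt t (hi T t)"
  have pq: "u p = s" "u q = t" "h p = hi T s" "h q = hi T t" by (simp_all add: p_def q_def)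
  have "closed_segment p q \<subseteq> frontier T \<inter> frontier U"
  proof
    fix z assume "z \<in> closed_segment p q"
    then obtain c where c: "0 \<le> c" "c \<le> 1" "z = (1 - c) *\<^sub>R p + c *\<^sub>R q"
      by (auto simp: in_segment)
    have uz: "u z = s + c * (t - s)"
      unfolding c(3) u_comb pq by (simp add: algebra_simps)
    have hz: "h z = hi T s + c * (hi T t - hi T s)"
      unfolding c(3) h_comb pq by (simp add: algebra_simps)
    have "c * (t - s) \<le> 1 * (t - s)" using c(2) t(2) by (intro mult_right_mono) auto
    also have "1 * (t - s) < e" using t by (simp add: dist_real_def)
    finally have "c * (t - s) < e" .
    moreover have "\<bar>c * (t - s)\<bar> = c * (t - s)" using c(1) t(2) by (intro abs_of_nonneg) simp
    ultimately have "dist (u z) s < e" unfolding uz dist_real_def by simp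
    from near[OF this] have z: "T \<in> Over (u z)" "U \<in> Over (u z)" "hi T (u z) = lo U (u z)"
      "hi T (u z) = hi T s + deriv (hi T) s * (u z - s)"
      by simp_all
    have rise: "hi T t - hi T s = deriv (hi T) s * (t - s)" using near[OF t(1)] by linarith
    have hz': "h z = hi T (u z)" unfolding z(4) unfolding hz uz rise by simp
    have "pt (u z) (h z) \<in> frontier T" by (rule in_frontier[OF z(1)]) (simp add: hz')
    moreover have "pt (u z) (h z) \<in> frontier U" by (rule in_frontier[OF z(2)]) (simp add: hz' z(3))
    ultimately show "z \<in> frontier T \<inter> frontier U" by simp
  qed
  moreover have "p \<noteq> q" using pq t by auto
  ultimately show ?thesis unfolding share_segment_def by blast
qed

lemma frontier_heights:
  assumes "T \<in> Over (u z)" "z \<in> frontier T"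
  shows "h z = lo T (u z) \<or> h z = hi T (u z)"
proof -
  have "z \<in> T" "z \<notin> interior T"
    using assms(2) simplex_2_closure_interior(3)[OF simplex[OF OverD(1)[OF assms(1)]]]
    by (auto simp: frontier_def closure_closed)
  then show ?thesis
    using tri_mem[OF OverD(2,3)[OF assms(1)], of "h z"] tri_interior_iff[OF OverD(2)[OF assms(1)], of z]
      OverD(3)[OF assms(1)] by auto
qed

text \<open>A shared segment is not parallel to the lines, so some noncritical line crosses it.
  There it lies on the boundary of both tiles, and equal upper or equal lower ends would force
  \<open>T = U\<close>.\<close>

lemma share_segment_adjacent:
  assumes T: "T \<in> \<T>" and U: "U \<in> \<T>" and "T \<noteq> U" "share_segment T U"
  obtains s where "s \<notin> crit" "T \<in> Over s" "U \<in> Over s" "lo U s = hi T s \<or> lo T s = hi U s"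
proof -
  obtain p' q' where pq': "p' \<noteq> q'" "closed_segment p' q' \<subseteq> frontier T \<inter> frontier U"
    using assms(4) unfolding share_segment_def by blast
  have sub: "frontier V \<subseteq> V" if "V \<in> \<T>" for V
    using simplex_2_closure_interior(3)[OF simplex[OF that]] by (rule frontier_subset_closed)
  have "u p' \<noteq> u q'"
  proof
    assume eq: "u p' = u q'"
    have "p' \<in> frontier T" "q' \<in> frontier T" using pq' by auto
    then have in_T: "p' \<in> T" "q' \<in> T" using sub[OF T] by auto
    show False
    proof (cases "over T (u p')")
      case True
      \<comment> \<open>With the midpoint there would be three frontier points on one line crossing
        \<open>T\<close>, but there are only two.\<close>
      define m where "m = (1 - 1/2) *\<^sub>R p' + (1/2) *\<^sub>R q'"
      have "m \<in> closed_segment p' q'"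
        unfolding in_segment m_def by (intro exI[of _ "1/2"]) simp
      then have "m \<in> frontier T" using pq' by blast
      moreover have "u m = u p'"
        using eq unfolding m_def u_comb by simp
      moreover have "h m = (h p' + h q') / 2"
        unfolding m_def h_comb by simp
      moreover have "h p' \<noteq> h q'" using pq'(1) eq coords_eqI by blast
      moreover have "T \<in> Over (u p')" using True T by (simp add: Over_def)
      ultimately show False
        using frontier_heights[of T p'] frontier_heights[of T q'] frontier_heights[of T m]
          \<open>p' \<in> frontier T\<close> \<open>q' \<in> frontier T\<close> eq by (auto simp: field_simps)
    next
      case False
      then have "p' \<in> verts" "q' \<in> verts"
        using end_vertex(2)[OF T in_T(1)] end_vertex(2)[OF T in_T(2)] eq by auto
      then show False using verts_inj eq pq'(1) by blast
    qed
  qed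
  then obtain p q where pq: "u p < u q" "closed_segment p q \<subseteq> frontier T \<inter> frontier U"
    using pq'(2) closed_segment_commute[of p' q'] by (metis linorder_neqE)
  have "infinite {u p<..<u q}" using pq(1) by (simp add: infinite_Ioo)
  then have "\<not> {u p<..<u q} \<subseteq> crit" using finite_subset[OF _ finite_crit] by blast
  then obtain s where "s \<in> {u p<..<u q}" "s \<notin> crit" by blast
  then have s: "u p < s" "s < u q" "s \<notin> crit" by simp_all
  define z where "z = pt s (chord p q s)"
  have "z \<in> closed_segment p q"
    unfolding z_def using pq(1) s by (intro pt_chord_closed_segment) auto
  then have z: "z \<in> frontier T" "z \<in> frontier U" using pq(2) by auto
  have uz: "u z = s" by (simp add: z_def)
  have "p \<in> frontier T \<inter> frontier U" "q \<in> frontier T \<inter> frontier U" using pq(2) by auto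
  then have "p \<in> T" "q \<in> T" "p \<in> U" "q \<in> U" using sub[OF T] sub[OF U] by auto
  then have over: "T \<in> Over s" "U \<in> Over s" using s T U by (auto simp: Over_def over_def)
  have "h z = lo T s \<or> h z = hi T s" "h z = lo U s \<or> h z = hi U s"
    using frontier_heights[of T z] frontier_heights[of U z] z over uz by auto
  then have "lo U s = hi T s \<or> lo T s = hi U s"
    using Over_hi_inj[OF over] Over_lo_inj[OF over] \<open>T \<noteq> U\<close> by auto
  then show thesis using that s(3) over by blast
qed

lemma rank_parity_constant:
  assumes "T \<in> Over s" "T \<in> Over t" "s \<notin> crit" "t \<notin> crit"
  shows "even (card (Above s T)) \<longleftrightarrow> even (card (Above t T))"
proof -
  obtain p q r where over: "\<And>x. over T x \<longleftrightarrow> u p < x \<and> x < u r"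
    using triE[OF OverD(2)[OF assms(1)]] by metis
  have "\<exists>P. \<forall>\<^sub>F y in nhds x. y \<notin> crit \<longrightarrow> even (card (Above y T)) = P" if "u p < x" "x < u r" for x
    using that over OverD(1)[OF assms(1)] by (intro rank_parity_near) (simp add: Over_def)
  then show ?thesis
    by (rule bool_constant_on_interval[OF finite_crit])
      (use over OverD(3)[OF assms(1)] OverD(3)[OF assms(2)] assms(3,4) in simp_all)
qed

text \<open>As only one tile has a vertex at \<open>A\<close>, nothing begins or ends on its line
  and the top tile remains on top nearby. The claim is about a neighbourhood because
  \<open>u A\<close> itself is critical.\<close>

lemma apex_tile:
  obtains T where "T \<in> Over (u A)" "tiles_at \<T> A = {T}" "\<forall>\<^sub>F t in nhds (u A). T \<in> Over t \<and> Above t T = {}"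
proof -
  have over_A: "over S (u A)" using base_order over_S by simp
  have hiA: "hi S (u A) = h A" using S.hi_left[of "u A"] base_order by simp
  obtain T where T: "T \<in> Over (u A)" "hi T (u A) = hi S (u A)"
    using top_tile[OF over_A] by blast
  have "A \<in> T" using tri_mem[OF OverD(2,3)[OF T(1)], of "h A"] T(2) hiA Over_in_S(4)[OF T(1)] by simp
  moreover have "A extreme_point_of S" by (simp add: S.extreme_iff)
  ultimately have "A extreme_point_of T"
    using subset_S[OF OverD(1)[OF T(1)]] by (auto simp: extreme_point_of_def)
  then have "T \<in> tiles_at \<T> A" using OverD(1)[OF T(1)] by (simp add: tiles_at_def)
  then have at: "tiles_at \<T> A = {T}" using card_A by (auto simp: card_1_singleton_iff)
  have "V = T" if V: "V \<in> left_ends (u A) \<union> right_ends (u A)" for V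
  proof -
    obtain z where z: "V \<in> \<T>" "z \<in> V" "u z = u A" "\<not> over V (u z)"
      using V by (auto simp: left_ends_def right_ends_def)
    then have "z = A" using verts_inj[of z A] end_vertex(2)[of V z] by (auto simp: verts_def)
    then have "V \<in> tiles_at \<T> A" using end_vertex(1)[of V z] z by (simp add: tiles_at_def)
    then show ?thesis using at by simp
  qed
  moreover have "T \<notin> left_ends (u A) \<union> right_ends (u A)"
    using OverD(3)[OF T(1)] by (auto simp: left_ends_def right_ends_def)
  ultimately have no_side: "side_ends (u A) t = {}" for t by (auto simp: side_ends_def)
  obtain \<kappa> where "\<forall>\<^sub>F t in nhds (u A). Above t T = Above (u A) T \<union> (if \<kappa> then side_ends (u A) t else {})"
    using Above_near[OF T(1)] by blast
  then have "\<forall>\<^sub>F t in nhds (u A). Above t T = {}"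
    by eventually_elim (simp add: no_side Above_top[OF T(2)])
  from that[OF T(1) at eventually_conj[OF eventually_Over[OF T(1)] this]] show thesis .
qed

section \<open>Proper colorings and rank parity\<close>

lemma proper_alternates:
  assumes "proper_coloring \<T> A black" "s \<notin> crit" "T \<in> Over s" "U \<in> Over s" "lo U s = hi T s"
  shows "black T \<noteq> black U"
proof -
  have "T \<noteq> U" using Over_in_S(4)[OF assms(3)] assms(5) by auto
  then show ?thesis
    using assms(1) adjacent_share_segment[OF assms(2-5)] OverD(1)[OF assms(3)] OverD(1)[OF assms(4)]
    unfolding proper_coloring_def by blast
qed

text \<open>Each step down flips both the color and the parity, so whether the two agree is decided
  by the top tile for the whole line.\<close>

lemma proper_on_line:
  assumes proper: "proper_coloring \<T> A black" and s: "s \<notin> crit"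
    and "T \<in> Over s" "Top \<in> Over s" "hi Top s = hi S s"
  shows "(black T \<longleftrightarrow> even (card (Above s T))) \<longleftrightarrow> black Top"
  using assms(3)
proof (induction "card (Above s T)" arbitrary: T rule: less_induct)
  case less
  show ?case
  proof (cases "hi T s = hi S s")
    case True
    then have "T = Top" using Over_hi_inj less.prems assms(4,5) by simp
    then show ?thesis using Above_top[OF True] by simp
  next
    case False
    then obtain U where U: "U \<in> Over s" "lo U s = hi T s" using next_above[OF less.prems] by blast
    have "card (Above s T) = Suc (card (Above s U))" by (rule card_Above_next[OF less.prems U])
    moreover have "black T \<noteq> black U" by (rule proper_alternates[OF proper s less.prems U])
    ultimately show ?thesis using less.hyps[OF _ U(1)] by auto
  qed
qed

text \<open>One tile decides whether color and parity agree on an entire line. A tile crossing all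
  nearby lines therefore carries the agreement over, starting near \<open>A\<close>, where the top
  tile is black with nothing above it.\<close>

lemma proper_coloring_rank:
  assumes proper: "proper_coloring \<T> A black" and "s \<notin> crit" "T \<in> Over s"
  shows "black T \<longleftrightarrow> even (card (Above s T))"
proof -
  define f where "f t \<longleftrightarrow> (\<forall>T\<in>Over t. black T \<longleftrightarrow> even (card (Above t T)))" for t
  have f_iff: "f t \<longleftrightarrow> (black T \<longleftrightarrow> even (card (Above t T)))" if t: "t \<notin> crit" "T \<in> Over t" for t T
  proof -
    obtain Top where Top: "Top \<in> Over t" "hi Top t = hi S t" by (rule top_tile[OF Over_in_S(1)[OF t(2)]])
    have line: "(black V \<longleftrightarrow> even (card (Above t V))) \<longleftrightarrow> black Top" if "V \<in> Over t" for V
      by (rule proper_on_line[OF proper t(1) that Top])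
    have "f t \<longleftrightarrow> (\<forall>V\<in>Over t. black Top)" unfolding f_def using line by (intro ball_cong refl)
    also have "\<dots> \<longleftrightarrow> black Top" using t(2) by blast
    finally show ?thesis using line[OF t(2)] by simp
  qed
  have local: "\<exists>P. \<forall>\<^sub>F t in nhds x. t \<notin> crit \<longrightarrow> f t = P" if x: "u B < x" "x < u C" for x
  proof -
    have "over S x" using x over_S by simp
    from top_tile[OF this] obtain V where V: "V \<in> Over x" by metis
    obtain P where P: "\<forall>\<^sub>F t in nhds x. t \<notin> crit \<longrightarrow> even (card (Above t V)) = P"
      using rank_parity_near[OF V] by blast
    have "\<forall>\<^sub>F t in nhds x. t \<notin> crit \<longrightarrow> f t = (black V = P)"
      using P eventually_Over[OF V]
    proof eventually_elim
      case (elim t)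
      show ?case using f_iff[of t V] elim by simp
    qed
    then show ?thesis by blast
  qed
  obtain V where "V \<in> Over (u A)" and V: "tiles_at \<T> A = {V}"
    "\<forall>\<^sub>F t in nhds (u A). V \<in> Over t \<and> Above t V = {}"
    by (rule apex_tile)
  obtain t where "u A < t" and "t \<notin> crit" and "V \<in> Over t \<and> Above t V = {}"
    by (rule pick_noncritical[OF V(2)])
  then have t: "t \<notin> crit" "V \<in> Over t" "Above t V = {}" by simp_all
  have "black V" using proper V(1) by (simp add: proper_coloring_def)
  then have "f t" using f_iff[OF t(1,2)] t(3) by simp
  moreover have "f t = f s"
    by (rule bool_constant_on_interval[OF finite_crit local])
      (use Over_in_S(1)[OF t(2)] Over_in_S(1)[OF assms(3)] over_S t(1) assms(2) in simp_all)
  ultimately show ?thesis using f_iff[OF assms(2,3)] by simp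
qed

lemma proper_coloring_exists: "\<exists>black. proper_coloring \<T> A black"
proof -
  \<comment> \<open>By \<open>rank_parity_constant\<close> the witness \<open>s\<close> is
    immaterial, so every noncritical line across \<open>T\<close> gives its color.\<close>
  define black where "black T \<longleftrightarrow> (\<exists>s. s \<notin> crit \<and> T \<in> Over s \<and> even (card (Above s T)))" for T
  have black_iff: "black T \<longleftrightarrow> even (card (Above s T))" if "s \<notin> crit" "T \<in> Over s" for s T
    using rank_parity_constant that unfolding black_def by blast
  have "proper_coloring \<T> A black" unfolding proper_coloring_def
  proof (intro conjI ballI impI)
    fix T U assume T: "T \<in> \<T>" and U: "U \<in> \<T>" and *: "T \<noteq> U \<and> share_segment T U"
    obtain s where s: "s \<notin> crit" "T \<in> Over s" "U \<in> Over s" "lo U s = hi T s \<or> lo T s = hi U s"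
      using share_segment_adjacent[OF T U] * by blast
    have "card (Above s T) = Suc (card (Above s U)) \<or> card (Above s U) = Suc (card (Above s T))"
      using card_Above_next[OF s(2,3)] card_Above_next[OF s(3,2)] s(4) by blast
    then show "black T \<noteq> black U"
      using black_iff[OF s(1,2)] black_iff[OF s(1,3)] by auto
  next
    fix T assume "T \<in> tiles_at \<T> A"
    obtain V where "V \<in> Over (u A)" and V: "tiles_at \<T> A = {V}"
      "\<forall>\<^sub>F t in nhds (u A). V \<in> Over t \<and> Above t V = {}"
      by (rule apex_tile)
    obtain t where "u A < t" and "t \<notin> crit" and "V \<in> Over t \<and> Above t V = {}"
      by (rule pick_noncritical[OF V(2)])
    then have t: "t \<notin> crit" "V \<in> Over t" "Above t V = {}" by simp_all
    show "black T" using black_iff[OF t(1,2)] t(3) V(1) \<open>T \<in> tiles_at \<T> A\<close> by simp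
  qed
  then show ?thesis by blast
qed

section \<open>The number of crossed tiles and the signed perimeter\<close>

lemma count_parity:
  assumes "s \<notin> crit" "over S s"
  shows "even (card (Over s)) \<longleftrightarrow> even (card (tiles_at \<T> B))"
proof -
  have no_over: "Over (u B) = {}" using Over_in_S(1) over_S by fastforce
  have right: "right_ends (u B) = tiles_at \<T> B"
  proof (intro equalityI subsetI)
    fix T assume "T \<in> right_ends (u B)"
    then obtain z where z: "T \<in> \<T>" "z \<in> T" "u z = u B" "\<not> over T (u z)"
      by (auto simp: right_ends_def)
    then have "z = B" using verts_inj[of z B] end_vertex(2)[of T z] by (auto simp: verts_def)
    then show "T \<in> tiles_at \<T> B" using end_vertex(1)[of T z] z by (simp add: tiles_at_def)
  next
    fix T assume "T \<in> tiles_at \<T> B"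
    then have T: "T \<in> \<T>" "B \<in> T" using extreme_in by (auto simp: tiles_at_def)
    moreover have "\<not> over T (u B)" using no_over T(1) by (auto simp: Over_def)
    moreover have "\<not> (\<exists>w\<in>T. u w < u B)" using subset_S[OF T(1)] S.mem_iff by fastforce
    ultimately show "T \<in> right_ends (u B)" by (auto simp: right_ends_def)
  qed
  \<comment> \<open>Just to the right of \<open>B\<close> the lines cross exactly the tiles that
    begin at \<open>B\<close>.\<close>
  have "\<forall>\<^sub>F t in nhds (u B). Over t = Over (u B) \<union> side_ends (u B) t \<and> t < u C"
    using base_order by (intro eventually_conj Over_near order_tendstoD(2)[OF filterlim_ident]) auto
  then obtain t where t: "u B < t" "t \<notin> crit" "Over t = Over (u B) \<union> side_ends (u B) t \<and> t < u C"
    by (rule pick_noncritical)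
  then have "Over t = tiles_at \<T> B" using no_over right by (simp add: side_ends_def)
  moreover have "even (card (Over s)) = even (card (Over t))"
    using assms t over_S count_parity_near
    by (intro bool_constant_on_interval[OF finite_crit, of "u B" "u C"]) auto
  ultimately show ?thesis by simp
qed

lemma line_sum:
  assumes s: "s \<notin> crit" and over: "over S s"
  shows "(\<Sum>T\<in>Over s. (-1) ^ card (Above s T) * (dens (hi T) s + dens (lo T) s)) =
    dens (hi S) s - (-1) ^ card (Over s) * dens (lo S) s"
proof -
  let ?\<sigma> = "\<lambda>T. (-1) ^ card (Above s T) :: real"
  obtain Top where Top: "Top \<in> Over s" "hi Top s = hi S s" by (rule top_tile[OF over])
  obtain Bot where Bot: "Bot \<in> Over s" "lo Bot s = lo S s" by (rule bottom_tile[OF over])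
  define up where "up T = (SOME U. U \<in> Over s \<and> lo U s = hi T s)" for T
  define down where "down T = (SOME U. U \<in> Over s \<and> hi U s = lo T s)" for T
  have up: "up T \<in> Over s" "lo (up T) s = hi T s" if "T \<in> Over s" "T \<noteq> Top" for T
  proof -
    have "hi T s \<noteq> hi S s" using Over_hi_inj[OF that(1) Top(1)] that(2) Top(2) by auto
    then have "\<exists>U. U \<in> Over s \<and> lo U s = hi T s" using next_above[OF that(1)] by blast
    from someI_ex[OF this] show "up T \<in> Over s" "lo (up T) s = hi T s" unfolding up_def by auto
  qed
  have down: "down T \<in> Over s" "hi (down T) s = lo T s" if "T \<in> Over s" "T \<noteq> Bot" for T
  proof -
    have "lo T s \<noteq> lo S s" using Over_lo_inj[OF that(1) Bot(1)] that(2) Bot(2) by auto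
    then have "\<exists>U. U \<in> Over s \<and> hi U s = lo T s" using next_below[OF that(1)] by blast
    from someI_ex[OF this] show "down T \<in> Over s" "hi (down T) s = lo T s" unfolding down_def by auto
  qed
  have up_Bot: "up T \<noteq> Bot" if "T \<in> Over s" "T \<noteq> Top" for T
    using up[OF that] Over_in_S(3,4)[OF that(1)] Bot(2) by auto
  have down_Top: "down T \<noteq> Top" if "T \<in> Over s" "T \<noteq> Bot" for T
    using down[OF that] Over_in_S(2,4)[OF that(1)] Top(2) by auto
  have up_down: "up (down T) = T" if "T \<in> Over s" "T \<noteq> Bot" for T
    using down[OF that] up[of "down T"] down_Top[OF that] that by (intro Over_lo_inj[of _ s]) auto
  have down_up: "down (up T) = T" if "T \<in> Over s" "T \<noteq> Top" for T
    using up[OF that] down[of "up T"] up_Bot[OF that] that by (intro Over_hi_inj[of _ s]) auto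
  have match: "- (?\<sigma> (down T) * dens (hi (down T)) s) = ?\<sigma> T * dens (lo T) s"
    if "T \<in> Over s" "T \<noteq> Bot" for T
  proof -
    have "dens (hi (down T)) s = dens (lo T) s"
      using adjacent_touch(1)[OF s down(1)[OF that] that(1)] down(2)[OF that] by (simp add: dens_def)
    moreover have "card (Above s (down T)) = Suc (card (Above s T))"
      using card_Above_next[OF down(1)[OF that] that(1)] down(2)[OF that] by simp
    ultimately show ?thesis by simp
  qed
  \<comment> \<open>Each lower boundary but the lowest is matched with the upper boundary of the
    tile below: equal density, opposite sign.\<close>
  have "(\<Sum>T\<in>Over s - {Bot}. ?\<sigma> T * dens (lo T) s) = (\<Sum>T\<in>Over s - {Top}. - (?\<sigma> T * dens (hi T) s))"
    by (rule sum.reindex_bij_witness[where i = up and j = down])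
      (use up down up_Bot down_Top up_down down_up match in auto)
  then have "(\<Sum>T\<in>Over s. ?\<sigma> T * (dens (hi T) s + dens (lo T) s)) =
      ?\<sigma> Top * dens (hi Top) s + ?\<sigma> Bot * dens (lo Bot) s"
    using Top(1) Bot(1)
    by (simp add: sum.distrib distrib_left sum.remove[of "Over s" Top "\<lambda>T. ?\<sigma> T * dens (hi T) s"]
        sum.remove[of "Over s" Bot "\<lambda>T. ?\<sigma> T * dens (lo T) s"] sum_negf)
  also have "?\<sigma> Top = 1" using Above_top[OF Top(2)] by simp
  \<comment> \<open>All crossed tiles except \<open>Bot\<close> itself lie above it; this shift by
    one causes the minus sign.\<close>
  also have "?\<sigma> Bot = - ((-1) ^ card (Over s))"
  proof -
    have "card (Over s) = Suc (card (Above s Bot))"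
      unfolding Above_bottom[OF Bot] by (rule card.remove[OF finite_Over(1) Bot(1)])
    then show ?thesis by simp
  qed
  also have "dens (hi Top) s = dens (hi S) s"
  proof -
    have "\<forall>\<^sub>F t in nhds s. hi Top t \<le> hi S t"
      using eventually_Over[OF Top(1)] by eventually_elim (rule Over_in_S)
    then show ?thesis
      using touching(1)[OF noncritical_affine(1)[OF Top(1) s] noncritical_affine_S(1)[OF over s]] Top(2)
      by (simp add: dens_def)
  qed
  also have "dens (lo Bot) s = dens (lo S) s"
  proof -
    have "\<forall>\<^sub>F t in nhds s. lo S t \<le> lo Bot t"
      using eventually_Over[OF Bot(1)] by eventually_elim (rule Over_in_S)
    then show ?thesis
      using touching(1)[OF noncritical_affine_S(2)[OF over s] noncritical_affine(2)[OF Bot(1) s]] Bot(2)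
      by (simp add: dens_def)
  qed
  finally show ?thesis by simp
qed

lemma coloring_number_sum:
  "real_of_int (coloring_number \<T> black) = (\<Sum>T\<in>\<T>. if black T then 1 else - 1)"
proof -
  have "(\<Sum>T\<in>\<T>. if black T then 1 else - 1 :: real) =
      (\<Sum>T\<in>{T\<in>\<T>. black T}. 1) + (\<Sum>T\<in>{T\<in>\<T>. \<not> black T}. - 1)"
    using sum.If_cases[OF finite_tiles, of black "\<lambda>_. 1 :: real" "\<lambda>_. - 1"]
    by (simp add: Int_def Collect_neg_eq)
  then show ?thesis by (simp add: coloring_number_def)
qed

text \<open>The same integral is evaluated tile by tile, giving signed perimeters, and line by line,
  where only the boundary of the large triangle is left.\<close>

lemma perimeter_equation:
  assumes perimeter: "\<And>p q r. convex hull {p, q, r} \<in> \<T> \<Longrightarrow> \<not> collinear {p, q, r} \<Longrightarrow>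
      dist p q + dist q r + dist p r = L"
    and proper: "proper_coloring \<T> A black"
  shows "of_int (coloring_number \<T> black) * L =
    dist A B + dist A C - (-1) ^ card (tiles_at \<T> B) * dist B C"
proof -
  let ?\<epsilon> = "\<lambda>T. if black T then 1 else - 1 :: real"
  \<comment> \<open>Extended by zero so that all tiles are integrated over the common
    interval.\<close>
  let ?g = "\<lambda>T s. if over T s then dens (hi T) s + dens (lo T) s else 0"
  have "(?g T has_integral L) {u B..u C}" if T: "T \<in> \<T>" for T
  proof -
    obtain p q r where pqr: "sorted_triangle u h E d p q r" and T_eq: "T = convex hull {p, q, r}"
      and over: "\<And>s. over T s \<longleftrightarrow> u p < s \<and> s < u r"
      using triE[OF tri_tile[OF T]] by metis
    interpret sorted_triangle u h E d p q r by (rule pqr)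
    have "p \<in> S" "r \<in> S" using subset_S[OF T] T_eq by (auto simp: hull_inc)
    then have sub: "{u p..u r} \<subseteq> {u B..u C}" using S.mem_iff by auto
    have "dist p q + dist q r + dist p r = L" using perimeter T T_eq noncollinear by simp
    then have "((\<lambda>s. dens (hi T) s + dens (lo T) s) has_integral L) {u p..u r}"
      using dens_has_integral_perimeter T_eq by simp
    then have "((\<lambda>s. if s \<in> {u p..u r} then dens (hi T) s + dens (lo T) s else 0) has_integral L) {u B..u C}"
      by (simp only: has_integral_restrict[OF sub])
    then show ?thesis
      by (rule has_integral_spike_finite[of "{u p, u r}", rotated 2]) (auto simp: over)
  qed
  then have "((\<lambda>s. \<Sum>T\<in>\<T>. ?\<epsilon> T * ?g T s) has_integral (\<Sum>T\<in>\<T>. ?\<epsilon> T * L)) {u B..u C}"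
    by (intro has_integral_sum finite_tiles has_integral_mult_right)
  moreover have "(\<Sum>T\<in>\<T>. ?\<epsilon> T * L) = of_int (coloring_number \<T> black) * L"
    by (simp only: coloring_number_sum sum_distrib_right)
  ultimately have 1: "((\<lambda>s. \<Sum>T\<in>\<T>. ?\<epsilon> T * ?g T s) has_integral of_int (coloring_number \<T> black) * L) {u B..u C}"
    by simp
  have "((\<lambda>s. dens (hi S) s - (-1) ^ card (tiles_at \<T> B) * dens (lo S) s) has_integral
      (dist B A + dist A C) - (-1) ^ card (tiles_at \<T> B) * dist B C) {u B..u C}"
    by (intro has_integral_diff has_integral_mult_right S.dens_hi_has_integral S.dens_lo_has_integral)
  then have "((\<lambda>s. \<Sum>T\<in>\<T>. ?\<epsilon> T * ?g T s) has_integral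
      (dist B A + dist A C) - (-1) ^ card (tiles_at \<T> B) * dist B C) {u B..u C}"
  proof (rule has_integral_spike_finite[OF finite_crit, rotated])
    fix s assume "s \<in> {u B..u C} - crit"
    then have s: "s \<notin> crit" "over S s" using S_vertices_critical over_S by (auto simp: less_le)
    have "(\<Sum>T\<in>\<T>. ?\<epsilon> T * ?g T s) = (\<Sum>T\<in>Over s. ?\<epsilon> T * (dens (hi T) s + dens (lo T) s))"
      unfolding Over_def using finite_tiles by (simp add: sum.inter_filter) (intro sum.cong, auto)
    also have "\<dots> = (\<Sum>T\<in>Over s. (-1) ^ card (Above s T) * (dens (hi T) s + dens (lo T) s))"
      using proper_coloring_rank[OF proper s(1)] by (intro sum.cong) auto
    also have "\<dots> = dens (hi S) s - (-1) ^ card (Over s) * dens (lo S) s"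
      by (rule line_sum[OF s])
    also have "(-1) ^ card (Over s) = ((-1) ^ card (tiles_at \<T> B) :: real)"
      using count_parity[OF s] by (cases "even (card (Over s))") auto
    finally show "(\<Sum>T\<in>\<T>. ?\<epsilon> T * ?g T s) = dens (hi S) s - (-1) ^ card (tiles_at \<T> B) * dens (lo S) s" .
  qed
  from has_integral_unique[OF 1 this] show ?thesis by (simp add: dist_commute)
qed

end

section \<open>Congruent tiles and a generic sweep direction\<close>

lemma isometry_convex_hull_image:
  fixes f :: "'a::euclidean_space \<Rightarrow> 'a"
  assumes "\<And>x y. dist (f x) (f y) = dist x y"
  shows "f ` (convex hull X) = convex hull (f ` X)"
proof -
  define g where "g x = f x - f 0" for x
  have "dist (g x) (g y) = dist (f x) (f y)" for x y by (simp add: g_def dist_norm)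
  then have lin: "linear g" by (intro isometry_linear) (simp_all add: g_def assms)
  have f: "f ` Y = (\<lambda>x. f 0 + x) ` g ` Y" for Y by (simp add: image_image g_def)
  show ?thesis
    unfolding f by (simp only: convex_hull_linear_image[OF lin] convex_hull_translation)
qed

text \<open>Congruence is a relation between point sets, so the correspondence of vertices is
  recovered from extreme points; it is known only up to a permutation, which the perimeter does not
  see.\<close>

lemma congruent_triangle_perimeter:
  fixes P Q R p q r :: "'a::euclidean_space"
  assumes "congruent_sets (convex hull {P, Q, R}) (convex hull {p, q, r})" "\<not> collinear {p, q, r}"
  shows "dist p q + dist q r + dist p r = dist P Q + dist Q R + dist P R"
proof -
  obtain f where f: "\<And>x y. dist (f x) (f y) = dist x y"
    and im: "f ` (convex hull {P, Q, R}) = convex hull {p, q, r}"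
    using assms(1) unfolding congruent_sets_def by blast
  have hull: "convex hull {p, q, r} = convex hull {f P, f Q, f R}"
    using isometry_convex_hull_image[OF f, of "{P, Q, R}"] im by simp
  have "\<not> affine_dependent {p, q, r}"
    using assms(2) collinear_3_eq_affine_dependent by blast
  then have mem: "x \<in> {f P, f Q, f R}" if "x \<in> {p, q, r}" for x
    using that extreme_point_of_convex_hull_affine_independent[of "{p, q, r}" x]
      extreme_point_of_convex_hull[of x "{f P, f Q, f R}"] hull by auto
  have "{p, q, p} = {p, q}" by auto
  then have "p \<noteq> q" "q \<noteq> r" "p \<noteq> r" using assms(2) collinear_2[of p q] collinear_2[of p r] by force+
  then have "dist p q + dist q r + dist p r = dist (f P) (f Q) + dist (f Q) (f R) + dist (f P) (f R)"
    using mem[of p] mem[of q] mem[of r] by (auto simp: dist_commute)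
  then show ?thesis by (simp only: f)
qed

text \<open>\<open>x\<close> and \<open>y\<close> are the coordinates in the basis
  \<open>C - B\<close>, \<open>A - B\<close>, by Cramer's rule. The direction \<open>d\<close>
  points from \<open>B + t *\<^sub>R E\<close> on \<open>BC\<close> to \<open>A\<close>, and
  \<open>u = x + t * y\<close> is constant along it; \<open>0 < t < 1\<close> puts \<open>A\<close>
  strictly between \<open>B\<close> and \<open>C\<close>.\<close>

lemma generic_coords:
  fixes A B C :: complex
  assumes ncol: "\<not> collinear {A, B, C}" and fin: "finite V"
  obtains u h E d where "coords u h E d" "u B < u A" "u A < u C" "coords.chord u h B C (u A) < h A"
    "inj_on u V"
proof -
  define E where "E = C - B"
  define F where "F = A - B"
  define D where "D = Im (cnj F * E)"
  have "D \<noteq> 0"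
  proof
    assume "D = 0"
    then have "E / F \<in> \<real>"
      by (simp add: D_def complex_is_Real_iff Im_divide algebra_simps)
    then have "collinear {0, F, E}" using collinear_iff_Reals by blast
    then have "collinear {A, B, C}" by (simp add: collinear_3 E_def F_def)
    then show False using ncol by simp
  qed
  define x where "x z = Im (cnj F * z) / D" for z
  define y where "y z = - Im (cnj E * z) / D" for z
  have lin: "linear x" "linear y"
    by (rule linearI; simp add: x_def y_def add_divide_distrib diff_divide_distrib algebra_simps)+
  have xy: "x E = 1" "y E = 0" "x F = 0" "y F = 1"
    using \<open>D \<noteq> 0\<close> by (auto simp: x_def y_def D_def field_simps)
  have coord: "z = x z *\<^sub>R E + y z *\<^sub>R F" for z
  proof -
    have D: "D * x z = Im (cnj F * z)" "D * y z = - Im (cnj E * z)"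
      using \<open>D \<noteq> 0\<close> by (simp_all add: x_def y_def)
    have "D * Re z = D * x z * Re E + D * y z * Re F" "D * Im z = D * x z * Im E + D * y z * Im F"
      unfolding D by (simp_all add: D_def algebra_simps)
    then have "D * Re z = D * (x z * Re E + y z * Re F)" "D * Im z = D * (x z * Im E + y z * Im F)"
      by (simp_all only: distrib_left mult.assoc)
    then show ?thesis using \<open>D \<noteq> 0\<close> by (simp add: complex_eq_iff)
  qed
  \<comment> \<open>The values of \<open>t\<close> at which two points fall on one line. Pairs with
    equal \<open>y\<close> only contribute 0 through division by zero; they are separated by
    \<open>x\<close> for every \<open>t\<close>.\<close>
  define bad where "bad = (\<lambda>(v, w). - (x v - x w) / (y v - y w)) ` (V \<times> V)"
  have "infinite {0<..<1 :: real}" by (simp add: infinite_Ioo)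
  moreover have "finite bad" using fin by (simp add: bad_def)
  ultimately have "\<not> {0<..<1} \<subseteq> bad" using finite_subset by blast
  then obtain t where "t \<in> {0<..<1}" and t_bad: "t \<notin> bad" by blast
  then have t: "0 < t" "t < 1" by auto
  define d where "d = F - t *\<^sub>R E"
  define u where "u z = x z + t * y z" for z
  have lin_u: "linear u"
    unfolding u_def by (rule linearI) (simp_all add: linear_add[OF lin(1)] linear_add[OF lin(2)]
        linear_scale[OF lin(1)] linear_scale[OF lin(2)] algebra_simps)
  have c: "coords u y E d"
  proof (rule coords.intro)
    show "z = u z *\<^sub>R E + y z *\<^sub>R d" for z
    proof -
      have "u z *\<^sub>R E + y z *\<^sub>R d = x z *\<^sub>R E + y z *\<^sub>R F" by (simp add: u_def d_def algebra_simps)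
      then show ?thesis using coord[of z] by simp
    qed
    show "u E = 1" "y E = 0" by (simp_all add: u_def xy)
    show "u d = 0" "y d = 1"
      by (simp_all add: u_def d_def linear_diff[OF lin(1)] linear_diff[OF lin(2)]
          linear_scale[OF lin(1)] linear_scale[OF lin(2)] xy)
  qed (rule lin_u lin(2))+
  have "u A - u B = u F" "u C - u B = u E" "y A - y B = y F" "y C - y B = y E"
    by (simp_all only: E_def F_def linear_diff[OF lin_u] linear_diff[OF lin(2)])
  moreover have "u F = t" "u E = 1" by (simp_all add: u_def xy)
  ultimately have diffs: "u A = u B + t" "u C = u B + 1" "y A = y B + 1" "y C = y B"
    unfolding xy by linarith+
  have "inj_on u V"
  proof (rule inj_onI, rule ccontr)
    fix v w assume vw: "v \<in> V" "w \<in> V" "u v = u w" "v \<noteq> w"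
    have *: "x v - x w + t * (y v - y w) = 0" using vw(3) by (simp add: u_def algebra_simps)
    have "y v \<noteq> y w"
    proof
      assume "y v = y w"
      then have "x v = x w" using * by simp
      then show False using vw(4) coord[of v] coord[of w] \<open>y v = y w\<close> by metis
    qed
    then have "t = - (x v - x w) / (y v - y w)" using * by (simp add: field_simps)
    then have "t \<in> bad" using vw(1,2) unfolding bad_def by (intro image_eqI[of _ _ "(v, w)"]) auto
    then show False using t_bad by simp
  qed
  moreover have "coords.chord u y B C (u A) < y A"
    by (simp add: coords.chord_def[OF c] coords.slope_def[OF c] diffs)
  ultimately show thesis using that[OF c] t diffs by simp
qed

theorem theorem1:
  fixes A B C P Q R :: complex
    and \<T> :: "complex set set"
    and a b c X Y Z :: real
  assumes "\<not> collinear {A, B, C}"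
    and "\<not> collinear {P, Q, R}"
    and "a = dist Q R" and "b = dist R P" and "c = dist P Q"
    and "tiling \<T> (convex hull {A, B, C})"
    and "\<forall>T\<in>\<T>. congruent_sets (convex hull {P, Q, R}) T"
    and "card (tiles_at \<T> A) = 1"
    and "\<forall>v. boundary_vertex \<T> A B C v \<longrightarrow> odd (card (tiles_at \<T> v))"
    and "\<forall>v. interior_vertex \<T> A B C v \<longrightarrow> even (card (tiles_at \<T> v))"
    and "even (card (tiles_at \<T> B)) \<longleftrightarrow> even (card (tiles_at \<T> C))"
    and "X = dist A B" and "Y = dist B C" and "Z = dist A C"
  shows "(\<exists>black. proper_coloring \<T> A black) \<and>
    (\<forall>black. proper_coloring \<T> A black \<longrightarrow>
       (if odd (card (tiles_at \<T> B)) then X + Y + Z else X - Y + Z)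
         = of_int (coloring_number \<T> black) * (a + b + c))"
proof -
  have "finite ({A, B, C} \<union> {v. tiling_vertex \<T> v})"
    using assms(6) finite_tiling_vertices[of \<T>] by (simp add: tiling_def)
  from generic_coords[OF assms(1) this] obtain u h E d where coords: "coords u h E d"
    "u B < u A" "u A < u C" "coords.chord u h B C (u A) < h A"
    and inj: "inj_on u ({A, B, C} \<union> {v. tiling_vertex \<T> v})"
    by metis
  interpret tiled_triangle u h E d A B C \<T>
  proof (intro tiled_triangle.intro tiled_triangle_axioms.intro)
    show "v = w" if "v \<in> {A, B, C} \<union> Collect (tiling_vertex \<T>)"
      "w \<in> {A, B, C} \<union> Collect (tiling_vertex \<T>)" "u v = u w" for v w
      by (rule inj_onD[OF inj that(3,1,2)])
  qed (use coords assms(1,6,8-10) in \<open>simp_all only: simp_thms\<close>)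
  have perimeter: "dist p q + dist q r + dist p r = a + b + c"
    if "convex hull {p, q, r} \<in> \<T>" "\<not> collinear {p, q, r}" for p q r
    using congruent_triangle_perimeter[of P Q R p q r] assms(3-5,7) that by (simp add: dist_commute)
  have "of_int (coloring_number \<T> black) * (a + b + c) =
      X + Z - (-1) ^ card (tiles_at \<T> B) * Y" if "proper_coloring \<T> A black" for black
    using perimeter_equation[OF perimeter that] assms(12-14) by simp
  then show ?thesis using proper_coloring_exists by auto
qed

end
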